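(* Let $A_Q=R/I_Q$ be an almost complete intersection algebra of codimension $3$ whose Cohen-Macaulay type is $t_Q=2$. Let $$0 \to R(-(d-s_1))\oplus R(-(d-s_2)) \to R(-s_1)\oplus R(-s_2)\oplus R(-(d_1+d^* ))\oplus R(-(d_2+d^* ))\oplus R(-(d_3+d^* )) \to$$ $$\to R(-d_1)\oplus R(-d_2)\oplus R(-d_3)\oplus R(-d^* ) \to I_Q \to 0$$ be its graded minimal free resolution, where $d=d_1+d_2+d_3+d^*$, $d_1\le d_2\le d_3$, $s_1\le s_2$. Then $I_Q$ has the same graded Betti numbers as the monomial ideal $$J=(x^{d_2},\,y^{d_3},\,z^{d^*},\,x^{s_2-d_3}y^{s_1-d_2}).$$
   Context: $k$ is an infinite field and $R=k[x,y,z]$ is the standard graded polynomial ring; all ideals are homogeneous. An almost complete intersection algebra of codimension $3$ is a standard graded artinian algebra $A_Q=R/I_Q$ with $I_Q$ minimally generated by $4$ homogeneous elements. $t_Q$ is the rank of the last module in the graded minimal free resolution of $A_Q$. (It is known that when $t_Q=2$ the graded minimal free resolution always has the displayed form for suitable integers.) *)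

theory Defs
  imports
    "HOL-Library.Poly_Mapping"
    "HOL-Library.Numeral_Type"
    "HOL-Library.Multiset"
    "Jordan_Normal_Form.Matrix_Kernel"
begin

text \<open>
  The polynomial ring \<open>R = k[x,y,z]\<close> is the monoid algebra over \<open>k\<close> of the monomials, which are the
  exponent vectors \<open>3 \<Rightarrow>\<^sub>0 nat\<close>; the elements \<open>0, 1, 2\<close> of the three-element type \<open>3\<close> index the
  variables \<open>x, y, z\<close>.
\<close>

type_synonym 'k poly3 = "(3 \<Rightarrow>\<^sub>0 nat) \<Rightarrow>\<^sub>0 'k"

definition var :: "3 \<Rightarrow> 'k::comm_ring_1 poly3"
  where "var i = Poly_Mapping.single (Poly_Mapping.single i 1) 1"

abbreviation X :: "'k::comm_ring_1 poly3" where "X \<equiv> var 0"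
abbreviation Y :: "'k::comm_ring_1 poly3" where "Y \<equiv> var 1"
abbreviation Z :: "'k::comm_ring_1 poly3" where "Z \<equiv> var 2"

definition mono_degree :: "(3 \<Rightarrow>\<^sub>0 nat) \<Rightarrow> nat"
  where "mono_degree m = (\<Sum>i\<in>UNIV. Poly_Mapping.lookup m i)"

text \<open>The zero polynomial is homogeneous of every degree, and is the only one of negative degree.\<close>

definition homogeneous_of_degree :: "int \<Rightarrow> 'k::comm_ring_1 poly3 \<Rightarrow> bool"
  where "homogeneous_of_degree n p \<longleftrightarrow> (\<forall>m\<in>Poly_Mapping.keys p. int (mono_degree m) = n)"

definition homogeneous :: "'k::comm_ring_1 poly3 \<Rightarrow> bool"
  where "homogeneous p \<longleftrightarrow> (\<exists>n. homogeneous_of_degree n p)"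

text \<open>Ideals are the submodules of \<open>R\<close> as a module over itself.\<close>

definition is_ideal :: "'k::comm_ring_1 poly3 set \<Rightarrow> bool"
  where "is_ideal = Modules.module.subspace (*)"

definition ideal_gen :: "'k::comm_ring_1 poly3 set \<Rightarrow> 'k poly3 set"
  where "ideal_gen = Modules.module.span (*)"

definition minimally_generated_by :: "'k::comm_ring_1 poly3 set \<Rightarrow> 'k poly3 set \<Rightarrow> bool"
  where "minimally_generated_by I G \<longleftrightarrow> ideal_gen G = I \<and> (\<forall>H. H \<subset> G \<longrightarrow> ideal_gen H \<noteq> I)"

text \<open>
  The ring \<open>R/I\<close> is artinian; its ideals are identified with the ideals of \<open>R\<close> containing \<open>I\<close>.
\<close>

definition artinian_quotient :: "'k::comm_ring_1 poly3 set \<Rightarrow> bool"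
  where "artinian_quotient I \<longleftrightarrow>
    (\<forall>K :: nat \<Rightarrow> 'k poly3 set.
       (\<forall>n. is_ideal (K n) \<and> I \<subseteq> K n \<and> K (Suc n) \<subseteq> K n) \<longrightarrow> (\<exists>N. \<forall>n\<ge>N. K n = K N))"

text \<open>Codimension 3 is automatic, as \<open>R\<close> has three variables.\<close>

definition almost_complete_intersection3 :: "'k::comm_ring_1 poly3 set \<Rightarrow> bool"
  where "almost_complete_intersection3 I \<longleftrightarrow>
    artinian_quotient I \<and>
    (\<exists>G. finite G \<and> card G = 4 \<and> (\<forall>g\<in>G. homogeneous g) \<and> minimally_generated_by I G)"

text \<open>
  A sequence of graded free modules is given by lists of shifts: \<open>F i = [a\<^sub>1, \<dots>, a\<^sub>n]\<close> stands for
  \<open>F\<^sub>i = R(-a\<^sub>1) \<oplus> \<dots> \<oplus> R(-a\<^sub>n)\<close>. The complex \<open>\<dots> \<rightarrow> F\<^sub>1 \<rightarrow> F\<^sub>0 \<rightarrow> I \<rightarrow> 0\<close> is given by the matrices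
  \<open>D (i+1)\<close> of \<open>F\<^sub>i\<^sub>+\<^sub>1 \<rightarrow> F\<^sub>i\<close> and the one-row matrix \<open>D 0\<close> of the composite \<open>F\<^sub>0 \<rightarrow> I \<rightarrow> R = R(0)\<close>.
\<close>

definition target_shifts :: "(nat \<Rightarrow> int list) \<Rightarrow> nat \<Rightarrow> int list"
  where "target_shifts F i = (case i of 0 \<Rightarrow> [0] | Suc j \<Rightarrow> F j)"

text \<open>A map \<open>\<Oplus>\<^sub>c R(-b\<^sub>c) \<rightarrow> \<Oplus>\<^sub>r R(-a\<^sub>r)\<close> is homogeneous of degree 0 if its \<open>(r,c)\<close> entry has degree \<open>b\<^sub>c - a\<^sub>r\<close>.\<close>

definition graded_map :: "int list \<Rightarrow> int list \<Rightarrow> 'k::comm_ring_1 poly3 mat \<Rightarrow> bool"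
  where "graded_map b a M \<longleftrightarrow>
    M \<in> carrier_mat (length a) (length b) \<and>
    (\<forall>r<length a. \<forall>c<length b. homogeneous_of_degree (b ! c - a ! r) (M $$ (r, c)))"

definition mat_image :: "'k::comm_ring_1 poly3 mat \<Rightarrow> 'k poly3 vec set"
  where "mat_image M = {M *\<^sub>v v | v. v \<in> carrier_vec (dim_col M)}"

text \<open>Minimality means that \<open>F\<^sub>i\<^sub>+\<^sub>1\<close> maps into \<open>(x,y,z) F\<^sub>i\<close>: no matrix entry has a constant term.\<close>

definition minimal_graded_free_resolution ::
    "(nat \<Rightarrow> int list) \<Rightarrow> (nat \<Rightarrow> 'k::comm_ring_1 poly3 mat) \<Rightarrow> 'k poly3 set \<Rightarrow> bool"
  where "minimal_graded_free_resolution F D I \<longleftrightarrow>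
    (\<forall>i. graded_map (F i) (target_shifts F i) (D i)) \<and>
    (\<lambda>v. v $ 0) ` mat_image (D 0) = I \<and>
    (\<forall>i. mat_kernel (D i) = mat_image (D (Suc i))) \<and>
    (\<forall>i. \<forall>r<dim_row (D (Suc i)). \<forall>c<dim_col (D (Suc i)).
       Poly_Mapping.lookup (D (Suc i) $$ (r, c)) 0 = 0)"

text \<open>The graded Betti number \<open>\<beta>\<^sub>i\<^sub>,\<^sub>j(I)\<close>: the number of summands \<open>R(-j)\<close> in \<open>F\<^sub>i\<close>.\<close>

definition graded_betti :: "'k::comm_ring_1 poly3 set \<Rightarrow> nat \<Rightarrow> int \<Rightarrow> nat"
  where "graded_betti I i j =
    (THE n. \<exists>F D. minimal_graded_free_resolution F D I \<and> n = count (mset (F i)) j)"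

text \<open>
  The Cohen-Macaulay type of \<open>R/I\<close>. For \<open>I \<noteq> 0\<close>, the last nonzero module of the minimal resolution
  of \<open>R/I\<close> is also the last one of the minimal resolution of \<open>I\<close>.
\<close>

definition cm_type :: "'k::comm_ring_1 poly3 set \<Rightarrow> nat"
  where "cm_type I =
    (THE t. \<exists>F D p. minimal_graded_free_resolution F D I \<and>
       F p \<noteq> [] \<and> (\<forall>q>p. F q = []) \<and> t = length (F p))"

end

theory Submission
  imports Defs
begin

text \<open>
  Graded Betti numbers are read off from any minimal graded free resolution, because the shifts of such
  a resolution are unique (\<open>minimal_resolution_shifts_unique\<close>). It therefore suffices to write
  down a minimal resolution of the monomial ideal \<open>J\<close> and to see that its shifts are the given ones.

  Put \<open>a = s2 - d3\<close> and \<open>b = s1 - d2\<close>. The ideal \<open>(x^d2, y^d3, x^a y^b)\<close> is perfect of codimension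
  two, generated by the maximal minors of a 3 by 2 matrix, and \<open>z^dst\<close> is regular modulo it. The
  tensor product of the two resolutions resolves \<open>J\<close>, and its shifts are the given ones as soon as
  \<open>s1 + s2 = d1 + d2 + d3\<close>. It is minimal as soon as no exponent in it degenerates, that is, if
  \<open>d2 < s1\<close>, \<open>d3 < s2\<close> and \<open>0 < dst\<close>. So everything rests on these numerical facts
  (\<open>type_two_shift_bounds\<close>). They are usually deduced from the structure theorem that an almost
  complete intersection of codimension three and type two is a hypersurface section of a perfect
  ideal of codimension two. Here they are extracted from the shifts of the resolution and the finite
  length of \<open>R/I\<close>.

  The equality \<open>s1 + s2 = d1 + d2 + d3\<close> says that the alternating sum of the shifts vanishes
  (\<open>shift_sum\<close>). Multiplication by a power of a variable that lies in \<open>I\<close> is null-homotopic on the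
  resolution of \<open>R/I\<close>. The homotopy and the differential combine to a square matrix whose determinant
  divides a power of \<open>x\<close>. This determinant depends only on the multiplier, so that comparing the
  multipliers \<open>x^N\<close> and \<open>y^N\<close> determines it up to a unit. Its degree is then known, and this degree
  is the alternating sum of the shifts up to an explicit term.

  The inequalities come from duality. Since \<open>R/I\<close> has finite length, the dual of the resolution is
  exact except at its end (\<open>dual_exact\<close>); the proof is a diagram chase with the regular sequence
  \<open>x^N, y^N, z^N\<close> (\<open>acyclicity\<close>). Exactness of the dual has two consequences for the last differential
  \<open>D2\<close>: no row of it vanishes (\<open>no_zero_row\<close>), and two rows that are supported in one common column
  force an inequality between the shifts (\<open>two_rows_one_column_bound\<close>). Moreover every column of
  \<open>D2\<close> generates an ideal of finite colength and hence has at least three nonzero entries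
  (\<open>third_nonzero_entry\<close>). If one of the inequalities failed, degree reasons would produce zeros in
  \<open>D2\<close> that contradict these facts.
\<close>

section \<open>Terms, powers of variables and homogeneity\<close>

text \<open>Both the homogeneous components of a polynomial and its remainder modulo a power of a variable
  select the terms whose exponent vector satisfies a condition.\<close>

definition restrict_terms :: "('a \<Rightarrow> bool) \<Rightarrow> ('a \<Rightarrow>\<^sub>0 'b::zero) \<Rightarrow> 'a \<Rightarrow>\<^sub>0 'b"
  where "restrict_terms P f = Abs_poly_mapping (\<lambda>m. if P m then Poly_Mapping.lookup f m else 0)"

lemma lookup_restrict_terms:
  "Poly_Mapping.lookup (restrict_terms P f) m = (if P m then Poly_Mapping.lookup f m else 0)"
proof -
  have "finite {m. (if P m then Poly_Mapping.lookup f m else 0) \<noteq> 0}"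
    by (rule finite_subset[OF _ finite_keys[of f]]) (auto simp: in_keys_iff)
  then show ?thesis by (simp add: restrict_terms_def)
qed

lemma keys_restrict_terms:
  "Poly_Mapping.keys (restrict_terms P f) = {m \<in> Poly_Mapping.keys f. P m}"
  by (auto simp: in_keys_iff lookup_restrict_terms split: if_splits)

lemma restrict_terms_add:
  "restrict_terms P (f + g) = restrict_terms P f + restrict_terms P (g::'a \<Rightarrow>\<^sub>0 'b::monoid_add)"
  by (rule poly_mapping_eqI) (simp add: lookup_restrict_terms lookup_add)

lemma restrict_terms_0 [simp]: "restrict_terms P 0 = 0"
  by (rule poly_mapping_eqI) (simp add: lookup_restrict_terms)

lemma restrict_terms_sum:
  "restrict_terms P (\<Sum>x\<in>S. f x) = (\<Sum>x\<in>S. restrict_terms P (f x :: 'a \<Rightarrow>\<^sub>0 'b::comm_monoid_add))"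
  by (induction S rule: infinite_finite_induct) (auto simp: restrict_terms_add)

lemma restrict_terms_id: "(\<And>m. m \<in> Poly_Mapping.keys f \<Longrightarrow> P m) \<Longrightarrow> restrict_terms P f = f"
  by (rule poly_mapping_eqI) (auto simp: lookup_restrict_terms in_keys_iff)

lemma restrict_terms_eq_0: "(\<And>m. m \<in> Poly_Mapping.keys f \<Longrightarrow> \<not> P m) \<Longrightarrow> restrict_terms P f = 0"
  by (rule poly_mapping_eqI) (auto simp: lookup_restrict_terms in_keys_iff)

lemma restrict_terms_split:
  "f = restrict_terms P f + restrict_terms (\<lambda>m. \<not> P m) (f::'a \<Rightarrow>\<^sub>0 'b::monoid_add)"
  by (rule poly_mapping_eqI) (simp add: lookup_restrict_terms lookup_add)

text \<open>If the condition on a product depends only on one factor, then selecting terms is linear over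
  the other factor. This gives the linearity of homogeneous components and of remainders.\<close>

lemma restrict_terms_mult:
  fixes f g :: "'a::comm_monoid_add \<Rightarrow>\<^sub>0 'b::semiring_0"
  assumes "\<And>a b. a \<in> Poly_Mapping.keys g \<Longrightarrow> Q (a + b) \<longleftrightarrow> P b"
  shows "restrict_terms Q (g * f) = g * restrict_terms P f"
proof -
  have "restrict_terms Q (g * restrict_terms P f) = g * restrict_terms P f"
  proof (rule restrict_terms_id)
    fix m assume "m \<in> Poly_Mapping.keys (g * restrict_terms P f)"
    then obtain a b where "m = a + b" "a \<in> Poly_Mapping.keys g" "P b"
      using keys_mult[of g "restrict_terms P f"] unfolding keys_restrict_terms by blast
    with assms show "Q m" by simp
  qed
  moreover have "restrict_terms Q (g * restrict_terms (\<lambda>m. \<not> P m) f) = 0"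
  proof (rule restrict_terms_eq_0)
    fix m assume "m \<in> Poly_Mapping.keys (g * restrict_terms (\<lambda>m. \<not> P m) f)"
    then obtain a b where "m = a + b" "a \<in> Poly_Mapping.keys g" "\<not> P b"
      using keys_mult[of g "restrict_terms (\<lambda>m. \<not> P m) f"] unfolding keys_restrict_terms by blast
    with assms show "\<not> Q m" by simp
  qed
  ultimately show ?thesis
    by (subst restrict_terms_split[of f P]) (simp add: distrib_left restrict_terms_add)
qed

lemma var_power: "(var i :: 'k::comm_ring_1 poly3) ^ n = Poly_Mapping.single (Poly_Mapping.single i n) 1"
  by (induction n) (simp_all add: var_def mult_single flip: single_add)

lemma var_power_neq_0 [simp]: "(var i :: 'k::field poly3) ^ n \<noteq> 0"
  by (metis keys_single keys_zero var_power insert_not_empty zero_neq_one)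

lemma var_neq_0 [simp]: "(var i :: 'k::field poly3) \<noteq> 0"
  using var_power_neq_0[of i 1] by simp

lemma var_power_dvdI:
  fixes f :: "'k::comm_ring_1 poly3"
  assumes "\<And>m. m \<in> Poly_Mapping.keys f \<Longrightarrow> n \<le> Poly_Mapping.lookup m i"
  shows "var i ^ n dvd f"
proof -
  have "f = (\<Sum>m\<in>Poly_Mapping.keys f. Poly_Mapping.single m (Poly_Mapping.lookup f m))"
    by (rule poly_mapping_eqI) (simp add: lookup_sum lookup_single when_def sum.delta in_keys_iff)
  moreover have "var i ^ n dvd Poly_Mapping.single m (Poly_Mapping.lookup f m)"
    if "m \<in> Poly_Mapping.keys f" for m
  proof
    have "m = Poly_Mapping.single i n + (m - Poly_Mapping.single i n)"
      by (rule poly_mapping_eqI)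
         (use assms[OF that] in \<open>auto simp: lookup_add lookup_minus lookup_single when_def\<close>)
    then show "Poly_Mapping.single m (Poly_Mapping.lookup f m) =
        var i ^ n * Poly_Mapping.single (m - Poly_Mapping.single i n) (Poly_Mapping.lookup f m)"
      by (simp add: var_power mult_single)
  qed
  ultimately show ?thesis by (metis (no_types, lifting) dvd_sum)
qed

text \<open>Reduction modulo a power of one variable commutes with multiplication by the other variables.
  It replaces divisibility theory: the regularity of \<open>x^N, y^N, z^N\<close> follows from it by reducing equations.\<close>

definition var_remainder :: "3 \<Rightarrow> nat \<Rightarrow> 'k::comm_ring_1 poly3 \<Rightarrow> 'k poly3"
  where "var_remainder i n = restrict_terms (\<lambda>m. Poly_Mapping.lookup m i < n)"

lemma var_remainder_add: "var_remainder i n (f + g) = var_remainder i n f + var_remainder i n g"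
  by (simp add: var_remainder_def restrict_terms_add)

lemma var_remainder_multiple: "var_remainder i n (var i ^ n * f) = 0"
  unfolding var_remainder_def
proof (rule restrict_terms_eq_0)
  fix m assume "m \<in> Poly_Mapping.keys (var i ^ n * f)"
  then show "\<not> Poly_Mapping.lookup m i < n"
    using keys_mult[of "var i ^ n" f] by (force simp: var_power lookup_add)
qed

lemma var_remainder_other_var:
  assumes "j \<noteq> i"
  shows "var_remainder i n (var j ^ k * f) = var j ^ k * var_remainder i n f"
  unfolding var_remainder_def
  by (rule restrict_terms_mult)
     (use assms in \<open>auto simp: var_power lookup_add lookup_single when_def split: if_splits\<close>)

lemma var_remainder_decomp: "\<exists>q. f = var_remainder i n f + var i ^ n * q"
proof -
  have "var i ^ n dvd restrict_terms (\<lambda>m. \<not> Poly_Mapping.lookup m i < n) f"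
    by (rule var_power_dvdI) (auto simp: keys_restrict_terms)
  then show ?thesis
    using restrict_terms_split[of f "\<lambda>m. Poly_Mapping.lookup m i < n"]
    unfolding var_remainder_def by (metis dvdE)
qed

lemma var_remainder_0_dvd: "var_remainder i n f = 0 \<Longrightarrow> var i ^ n dvd f"
  by (metis add_0 dvdI var_remainder_decomp)

text \<open>Reducing the equation modulo the power of \<open>var i\<close> kills the right side, and the power of
  \<open>var j\<close> survives as a factor, so the remainder of \<open>f\<close> is zero.\<close>

lemma var_powers_coprime:
  fixes f g :: "'k::field poly3"
  assumes "var j ^ k * f = var i ^ n * g" and "i \<noteq> j"
  obtains h where "f = var i ^ n * h" and "g = var j ^ k * h"
proof -
  have "var j ^ k * var_remainder i n f = 0"
    using assms var_remainder_other_var[of j i n k f] by (simp add: var_remainder_multiple)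
  then have "var i ^ n dvd f"
    by (intro var_remainder_0_dvd) (use var_power_neq_0 in \<open>metis mult_eq_0_iff\<close>)
  then obtain h where h: "f = var i ^ n * h" by blast
  then have "var i ^ n * g = var i ^ n * (var j ^ k * h)"
    by (metis assms(1) mult.left_commute)
  then have "g = var j ^ k * h"
    using mult_left_cancel[OF var_power_neq_0[of i n]] by metis
  with h that show thesis by blast
qed

text \<open>Reduction modulo the power of \<open>var a\<close> turns the relation into one between the two other powers.\<close>

lemma third_var_power_regular:
  fixes f p q :: "'k::field poly3"
  assumes "var c ^ l * f = var a ^ n * p + var b ^ m * q" and "a \<noteq> b" "a \<noteq> c" "b \<noteq> c"
  obtains p' q' where "f = var a ^ n * p' + var b ^ m * q'"
proof -
  have "var c ^ l * var_remainder a n f = var b ^ m * var_remainder a n q"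
    using assms var_remainder_other_var[of c a n l f] var_remainder_other_var[of b a n m q]
    by (simp add: var_remainder_multiple var_remainder_add)
  then obtain q' where "var_remainder a n f = var b ^ m * q'"
    using assms(4) by (rule var_powers_coprime)
  then show thesis using var_remainder_decomp[of f a n] that by (metis add.commute)
qed

lemma homogeneous_of_degree_0 [simp]: "homogeneous_of_degree n 0"
  by (simp add: homogeneous_of_degree_def)

lemma homogeneous_of_degree_add:
  "homogeneous_of_degree n f \<Longrightarrow> homogeneous_of_degree n g \<Longrightarrow> homogeneous_of_degree n (f + g)"
  unfolding homogeneous_of_degree_def using keys_add[of f g] by blast

lemma homogeneous_of_degree_sum:
  "(\<And>x. x \<in> S \<Longrightarrow> homogeneous_of_degree n (f x)) \<Longrightarrow> homogeneous_of_degree n (\<Sum>x\<in>S. f x)"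
  by (induction S rule: infinite_finite_induct) (auto intro: homogeneous_of_degree_add)

lemma keys_uminus: "Poly_Mapping.keys (- f) = Poly_Mapping.keys (f :: 'a \<Rightarrow>\<^sub>0 'b::ab_group_add)"
  by (auto simp: in_keys_iff)

lemma homogeneous_of_degree_uminus [simp]:
  "homogeneous_of_degree n (- f) = homogeneous_of_degree n f"
  by (simp add: homogeneous_of_degree_def keys_uminus)

lemma homogeneous_of_degree_diff:
  "homogeneous_of_degree n f \<Longrightarrow> homogeneous_of_degree n g \<Longrightarrow> homogeneous_of_degree n (f - g)"
  using homogeneous_of_degree_add[of n f "- g"] by simp

lemma mono_degree_add: "mono_degree (a + b) = mono_degree a + mono_degree b"
  by (simp add: mono_degree_def lookup_add sum.distrib)

lemma homogeneous_of_degree_mult: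
  assumes "homogeneous_of_degree m f" "homogeneous_of_degree n g"
  shows "homogeneous_of_degree (m + n) (f * g)"
  unfolding homogeneous_of_degree_def
proof
  fix k assume "k \<in> Poly_Mapping.keys (f * g)"
  then obtain a b where "k = a + b" "a \<in> Poly_Mapping.keys f" "b \<in> Poly_Mapping.keys g"
    using keys_mult[of f g] by blast
  then show "int (mono_degree k) = m + n"
    using assms by (auto simp: mono_degree_add homogeneous_of_degree_def)
qed

lemma mono_degree_single [simp]: "mono_degree (Poly_Mapping.single i n) = n"
  by (simp add: mono_degree_def lookup_single when_def sum.delta)

lemma homogeneous_of_degree_var_power [simp]:
  "homogeneous_of_degree (int n) (var i ^ n :: 'k::comm_ring_1 poly3)"
  by (auto simp: homogeneous_of_degree_def var_power)

lemma mono_degree_eq_0 [simp]: "mono_degree m = 0 \<longleftrightarrow> m = 0"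
proof
  assume "mono_degree m = 0"
  then have "Poly_Mapping.lookup m i = 0" for i by (simp add: mono_degree_def)
  then show "m = 0" by (intro poly_mapping_eqI) simp
qed (simp add: mono_degree_def)

lemma homogeneous_of_degree_1 [simp]: "homogeneous_of_degree 0 (1 :: 'k::comm_ring_1 poly3)"
  using homogeneous_of_degree_var_power[of 0] by simp

lemma homogeneous_negative_degree: "homogeneous_of_degree n f \<Longrightarrow> n < 0 \<Longrightarrow> f = 0"
  by (rule poly_mapping_eqI, rule ccontr) (force simp: homogeneous_of_degree_def in_keys_iff)

lemma homogeneous_const_term_0:
  assumes "homogeneous_of_degree n f" "n \<noteq> 0"
  shows "Poly_Mapping.lookup f 0 = 0"
proof (rule ccontr)
  assume "Poly_Mapping.lookup f 0 \<noteq> 0"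
  then have "int (mono_degree 0) = n"
    using assms(1) by (auto simp: homogeneous_of_degree_def in_keys_iff)
  with assms(2) show False by (simp add: mono_degree_eq_0[THEN iffD2])
qed

lemma homogeneous_nonpos_degree:
  assumes "homogeneous_of_degree n f" "n \<le> 0" "Poly_Mapping.lookup f 0 = 0"
  shows "f = 0"
proof (rule poly_mapping_eqI, rule ccontr)
  fix m assume "Poly_Mapping.lookup f m \<noteq> Poly_Mapping.lookup 0 m"
  then have "m \<in> Poly_Mapping.keys f" "m \<noteq> 0" using assms(3) by (auto simp: in_keys_iff)
  then show False using assms by (force simp: homogeneous_of_degree_def)
qed

text \<open>The constant term is the residue map to the field \<open>k\<close>; minimality of a resolution is a statement
  about the image of its matrices under this ring homomorphism.\<close>

lemma const_term_mult:
  "Poly_Mapping.lookup (f * g) 0 = Poly_Mapping.lookup f 0 * Poly_Mapping.lookup (g :: 'k::comm_ring_1 poly3) 0"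
proof -
  \<comment> \<open>Split off the constant terms \<open>c\<close> and \<open>d\<close>; a product with a factor without constant term has none.\<close>
  define u v where "u = restrict_terms (\<lambda>m. m \<noteq> 0) f" and "v = restrict_terms (\<lambda>m. m \<noteq> 0) g"
  define c d where "c = Poly_Mapping.single (0 :: 3 \<Rightarrow>\<^sub>0 nat) (Poly_Mapping.lookup f 0)"
    and "d = Poly_Mapping.single (0 :: 3 \<Rightarrow>\<^sub>0 nat) (Poly_Mapping.lookup g 0)"
  have f: "f = c + u"
    by (rule poly_mapping_eqI) (auto simp: c_def u_def lookup_restrict_terms lookup_add lookup_single when_def)
  have g: "g = d + v"
    by (rule poly_mapping_eqI) (auto simp: d_def v_def lookup_restrict_terms lookup_add lookup_single when_def)
  have z: "Poly_Mapping.lookup (restrict_terms (\<lambda>m. m \<noteq> 0) u * v) 0 = 0" for u v :: "'k poly3"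
  proof (rule ccontr)
    assume "\<not> ?thesis"
    then have "0 \<in> Poly_Mapping.keys (restrict_terms (\<lambda>m. m \<noteq> 0) u * v)" by (simp add: in_keys_iff)
    then obtain a b :: "3 \<Rightarrow>\<^sub>0 nat" where "0 = a + b" "a \<noteq> 0"
      using keys_mult[of "restrict_terms (\<lambda>m. m \<noteq> 0) u" v] unfolding keys_restrict_terms by blast
    then have "mono_degree a + mono_degree b = 0" "mono_degree a \<noteq> 0"
      by (simp_all flip: mono_degree_add)
    then show False by simp
  qed
  have "f * g = c * d + v * c + u * (d + v)"
    unfolding f g by (simp add: algebra_simps)
  then show ?thesis by (simp add: lookup_add z u_def v_def c_def d_def mult_single)
qed

definition hom_component :: "int \<Rightarrow> 'k::comm_ring_1 poly3 \<Rightarrow> 'k poly3"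
  where "hom_component n = restrict_terms (\<lambda>m. int (mono_degree m) = n)"

lemma hom_component_homogeneous [simp]: "homogeneous_of_degree n (hom_component n f)"
  by (simp add: homogeneous_of_degree_def hom_component_def keys_restrict_terms)

lemma hom_component_id: "homogeneous_of_degree n f \<Longrightarrow> hom_component n f = f"
  by (simp add: homogeneous_of_degree_def hom_component_def restrict_terms_id)

lemma hom_component_mult:
  "homogeneous_of_degree m g \<Longrightarrow> hom_component n (g * f) = g * hom_component (n - m) f"
  unfolding hom_component_def
  by (rule restrict_terms_mult) (auto simp: homogeneous_of_degree_def mono_degree_add)

lemma hom_component_sum: "hom_component n (\<Sum>x\<in>S. f x) = (\<Sum>x\<in>S. hom_component n (f x))"
  by (simp add: hom_component_def restrict_terms_sum)

lemma hom_component_add: "hom_component n (f + g) = hom_component n f + hom_component n g"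
  by (simp add: hom_component_def restrict_terms_add)

lemma homogeneous_of_degree_prod:
  "(\<And>x. x \<in> S \<Longrightarrow> homogeneous_of_degree (n x) (f x)) \<Longrightarrow>
    homogeneous_of_degree (\<Sum>x\<in>S. n x) (\<Prod>x\<in>S. f x)"
  by (induction S rule: infinite_finite_induct) (auto intro: homogeneous_of_degree_mult)

lemma homogeneous_factor:
  fixes f g :: "'k::field poly3"
  assumes "homogeneous_of_degree m g" "g \<noteq> 0" "homogeneous_of_degree n (g * f)"
  shows "homogeneous_of_degree (n - m) f"
  using hom_component_mult[OF assms(1), of n f] hom_component_id[OF assms(3)] assms(2)
  by (metis hom_component_homogeneous mult_left_cancel)

text \<open>Both the unit and the part of its inverse in the complementary degree are nonzero, so neither
  degree is negative.\<close>

lemma homogeneous_unit_degree: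
  fixes f g :: "'k::field poly3"
  assumes f: "homogeneous_of_degree n f" and fg: "f * g = 1"
  shows "n = 0"
proof -
  have "f * hom_component (- n) g = 1"
    using hom_component_mult[OF f, of 0 g] hom_component_id[OF homogeneous_of_degree_1] fg by (metis diff_0)
  then have "f \<noteq> 0" "hom_component (- n) g \<noteq> 0" by auto
  then have "\<not> n < 0" "\<not> - n < 0"
    using homogeneous_negative_degree[OF f] homogeneous_negative_degree[OF hom_component_homogeneous[of "- n" g]] by blast+
  then show ?thesis by simp
qed

section \<open>Graded matrices and lifting\<close>

lemma graded_mapD:
  assumes "graded_map b a M"
  shows "M \<in> carrier_mat (length a) (length b)"
    and "\<And>r c. r < length a \<Longrightarrow> c < length b \<Longrightarrow> homogeneous_of_degree (b ! c - a ! r) (M $$ (r, c))"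
  using assms by (auto simp: graded_map_def)

lemma graded_map_mult:
  assumes "graded_map b a M" "graded_map c b N"
  shows "graded_map c a (M * N)"
proof -
  note M = graded_mapD[OF assms(1)] and N = graded_mapD[OF assms(2)]
  show ?thesis unfolding graded_map_def
  proof (intro conjI allI impI)
    show "M * N \<in> carrier_mat (length a) (length c)" using M(1) N(1) by simp
    fix r k assume rk: "r < length a" "k < length c"
    have "homogeneous_of_degree (c ! k - a ! r) (M $$ (r, j) * N $$ (j, k))" if "j < length b" for j
      using homogeneous_of_degree_mult[OF M(2)[OF rk(1) that] N(2)[OF that rk(2)]] by simp
    then show "homogeneous_of_degree (c ! k - a ! r) ((M * N) $$ (r, k))"
      using M(1) N(1) rk by (auto simp: scalar_prod_def intro!: homogeneous_of_degree_sum)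
  qed
qed

lemma graded_map_minus:
  "graded_map b a M \<Longrightarrow> graded_map b a N \<Longrightarrow> graded_map b a (M - N)"
  by (auto simp: graded_map_def intro!: homogeneous_of_degree_diff)

lemma graded_map_shift:
  "graded_map b a M \<Longrightarrow> graded_map (map ((+) s) b) (map ((+) s) a) M"
  by (auto simp: graded_map_def)

lemma graded_map_scalar:
  "homogeneous_of_degree s g \<Longrightarrow> graded_map (map ((+) s) a) a (g \<cdot>\<^sub>m 1\<^sub>m (length a))"
  by (auto simp: graded_map_def)

text \<open>Each term of the Leibniz expansion uses every row and every column once.\<close>

lemma graded_map_det:
  assumes M: "graded_map b a M" and len: "length a = length b"
  shows "homogeneous_of_degree (sum_list b - sum_list a) (det M)"
proof -
  let ?n = "length a"
  note MD = graded_mapD[OF M]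
  have "homogeneous_of_degree (sum_list b - sum_list a) (signof p * (\<Prod>i = 0..<?n. M $$ (i, p i)))"
    if p: "p permutes {0..<?n}" for p
  proof -
    have "(\<Sum>i = 0..<?n. b ! p i) = sum_list b"
      using sum.permute[OF p, of "\<lambda>i. b ! i"] len by (simp add: sum_list_sum_nth)
    then have "(\<Sum>i = 0..<?n. b ! p i - a ! i) = sum_list b - sum_list a"
      by (simp add: sum_subtractf sum_list_sum_nth)
    moreover have "homogeneous_of_degree (\<Sum>i = 0..<?n. b ! p i - a ! i) (\<Prod>i = 0..<?n. M $$ (i, p i))"
      using MD(2) len permutes_in_image[OF p] by (intro homogeneous_of_degree_prod) auto
    ultimately show ?thesis by (cases "evenperm p") (simp_all add: sign_def)
  qed
  then show ?thesis
    using MD(1) len by (auto simp: det_def' intro: homogeneous_of_degree_sum)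
qed

text \<open>A graded map commutes with taking homogeneous components, so the components of the right degrees
  of any preimage again form a preimage.\<close>

lemma graded_preimage:
  fixes M :: "'k::comm_ring_1 poly3 mat"
  assumes M: "graded_map b a M" and w: "w \<in> mat_image M"
    and hom: "\<And>r. r < length a \<Longrightarrow> homogeneous_of_degree (s - a ! r) (w $ r)"
  obtains v where "v \<in> carrier_vec (length b)" "M *\<^sub>v v = w"
    "\<And>c. c < length b \<Longrightarrow> homogeneous_of_degree (s - b ! c) (v $ c)"
proof -
  note MD = graded_mapD[OF M]
  from w obtain u where u: "u \<in> carrier_vec (length b)" "M *\<^sub>v u = w"
    using MD(1) by (auto simp: mat_image_def)
  define v where "v = vec (length b) (\<lambda>c. hom_component (s - b ! c) (u $ c))"
  have "(M *\<^sub>v v) $ r = w $ r" if r: "r < length a" for r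
  proof -
    have "w $ r = hom_component (s - a ! r) ((M *\<^sub>v u) $ r)"
      using hom[OF r] u(2) by (simp add: hom_component_id)
    also have "\<dots> = (\<Sum>c = 0..<length b. hom_component (s - a ! r) (M $$ (r, c) * u $ c))"
      using r MD(1) u(1) by (simp add: scalar_prod_def hom_component_sum)
    also have "\<dots> = (\<Sum>c = 0..<length b. M $$ (r, c) * v $ c)"
      using hom_component_mult[OF MD(2)[OF r]] by (intro sum.cong) (simp_all add: v_def)
    also have "\<dots> = (M *\<^sub>v v) $ r"
      using r MD(1) by (simp add: scalar_prod_def v_def)
    finally show ?thesis by simp
  qed
  moreover have "dim_vec w = length a" using u(2) MD(1) by auto
  ultimately have "M *\<^sub>v v = w"
    using MD(1) by (intro eq_vecI) auto
  then show thesis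
    using that[of v] by (simp add: v_def)
qed

lemma graded_lift_image:
  fixes N :: "'k::comm_ring_1 poly3 mat"
  assumes N: "graded_map c b N" and G: "graded_map s b G"
    and im: "\<And>j. j < length s \<Longrightarrow> col G j \<in> mat_image N"
  obtains H where "graded_map s c H" "N * H = G"
proof -
  note GD = graded_mapD[OF G] and ND = graded_mapD[OF N]
  have "\<exists>v. v \<in> carrier_vec (length c) \<and> N *\<^sub>v v = col G j \<and>
      (\<forall>k<length c. homogeneous_of_degree (s ! j - c ! k) (v $ k))" if j: "j < length s" for j
  proof -
    have "homogeneous_of_degree (s ! j - b ! r) (col G j $ r)" if "r < length b" for r
      using GD that j by simp
    from graded_preimage[OF N im[OF j] this] show ?thesis by metis
  qed
  then obtain v where v: "\<And>j. j < length s \<Longrightarrow> v j \<in> carrier_vec (length c)"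
    "\<And>j. j < length s \<Longrightarrow> N *\<^sub>v v j = col G j"
    "\<And>j k. j < length s \<Longrightarrow> k < length c \<Longrightarrow> homogeneous_of_degree (s ! j - c ! k) (v j $ k)"
    by metis
  define H where "H = mat (length c) (length s) (\<lambda>(k, j). v j $ k)"
  have colH: "col H j = v j" if "j < length s" for j
    using that v(1)[OF that] by (intro eq_vecI) (auto simp: H_def)
  have "N * H = G"
  proof (rule mat_col_eqI)
    fix j assume "j < dim_col G"
    then have j: "j < length s" using GD by simp
    then show "col (N * H) j = col G j"
      using ND(1) v(2)[OF j] colH[OF j] by (subst col_mult2[of _ "length b" "length c" _ "length s"]) (auto simp: H_def)
  qed (use GD ND in \<open>auto simp: H_def\<close>)
  moreover have "graded_map s c H"
    using v(3) by (auto simp: graded_map_def H_def)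
  ultimately show thesis using that by blast
qed

lemma cols_in_mat_kernel:
  assumes "M \<in> carrier_mat n m" "G \<in> carrier_mat m p" "M * G = 0\<^sub>m n p" "j < p"
  shows "col G j \<in> mat_kernel M"
proof (rule mat_kernelI[OF assms(1)])
  have "M *\<^sub>v col G j = col (M * G) j"
    using col_mult2[OF assms(1,2,4)] by simp
  also have "\<dots> = 0\<^sub>v n" unfolding assms(3) using assms(4) by simp
  finally show "M *\<^sub>v col G j = 0\<^sub>v n" .
qed (use assms in auto)

text \<open>A graded map into the middle of an exact sequence that composes to zero factors through the
  kernel. Comparison maps and homotopies are constructed in this way.\<close>

lemma graded_lift_kernel:
  fixes M N :: "'k::comm_ring_1 poly3 mat"
  assumes "graded_map b a M" "graded_map c b N" "mat_kernel M = mat_image N"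
    and "graded_map s b G" "M * G = 0\<^sub>m (length a) (length s)"
  obtains H where "graded_map s c H" "N * H = G"
  using graded_lift_image[OF assms(2,4)] cols_in_mat_kernel[OF _ _ assms(5)] assms(3)
    graded_mapD(1)[OF assms(1)] graded_mapD(1)[OF assms(4)] by metis

lemma lift_kernel:
  fixes M N :: "'k::comm_ring_1 poly3 mat"
  assumes M: "M \<in> carrier_mat n m" and N: "N \<in> carrier_mat m l" and ex: "mat_kernel M = mat_image N"
    and G: "G \<in> carrier_mat m p" and z: "M * G = 0\<^sub>m n p"
  obtains H where "H \<in> carrier_mat l p" "N * H = G"
proof -
  have "\<exists>v. v \<in> carrier_vec l \<and> N *\<^sub>v v = col G j" if "j < p" for j
    using cols_in_mat_kernel[OF M G z that] N unfolding ex by (auto simp: mat_image_def)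
  then obtain v where v: "\<And>j. j < p \<Longrightarrow> v j \<in> carrier_vec l"
    "\<And>j. j < p \<Longrightarrow> N *\<^sub>v v j = col G j"
    by metis
  define H where "H = mat l p (\<lambda>(k, j). v j $ k)"
  have colH: "col H j = v j" if "j < p" for j
    using that v(1)[OF that] by (intro eq_vecI) (auto simp: H_def)
  have "N * H = G"
  proof (rule mat_col_eqI)
    fix j assume "j < dim_col G"
    then have j: "j < p" using G by simp
    then show "col (N * H) j = col G j"
      using N v(2)[OF j] colH[OF j] by (subst col_mult2[of _ m l _ p]) (auto simp: H_def)
  qed (use G N in \<open>auto simp: H_def\<close>)
  then show thesis using that[of H] by (simp add: H_def)
qed

lemma exact_imp_complex:
  fixes M N :: "'k::comm_ring_1 poly3 mat"
  assumes M: "M \<in> carrier_mat n m" and N: "N \<in> carrier_mat m l" and ex: "mat_kernel M = mat_image N"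
  shows "M * N = 0\<^sub>m n l"
proof (rule mat_col_eqI)
  fix j assume "j < dim_col (0\<^sub>m n l)"
  then have j: "j < l" by simp
  have "col N j = N *\<^sub>v unit_vec l j" by (metis col_mult2[OF N one_carrier_mat j] right_mult_one_mat[OF N] col_one[OF j])
  then have "col N j \<in> mat_kernel M" unfolding ex using N by (auto simp: mat_image_def)
  then show "col (M * N) j = col (0\<^sub>m n l) j"
    using mat_kernelD(2)[OF M] j by (simp add: col_mult2[OF M N j] del: col_mult)
qed (use M N in auto)

lemma resolution_maps:
  assumes "minimal_graded_free_resolution F D I"
  shows "graded_map (F 0) [0] (D 0)" "\<And>i. graded_map (F (Suc i)) (F i) (D (Suc i))"
    "\<And>i. mat_kernel (D i) = mat_image (D (Suc i))"
    "\<And>i. D (Suc i) \<in> carrier_mat (length (F i)) (length (F (Suc i)))"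
    "D 0 \<in> carrier_mat 1 (length (F 0))"
    "\<And>i r c. r < length (F i) \<Longrightarrow> c < length (F (Suc i)) \<Longrightarrow> Poly_Mapping.lookup (D (Suc i) $$ (r, c)) 0 = 0"
    "(\<lambda>v. v $ 0) ` mat_image (D 0) = I"
proof -
  have g: "graded_map (F i) (target_shifts F i) (D i)" for i
    using assms by (simp add: minimal_graded_free_resolution_def)
  show 1: "graded_map (F 0) [0] (D 0)" using g[of 0] by (simp add: target_shifts_def)
  show 2: "graded_map (F (Suc i)) (F i) (D (Suc i))" for i using g[of "Suc i"] by (simp add: target_shifts_def)
  show 3: "D (Suc i) \<in> carrier_mat (length (F i)) (length (F (Suc i)))" for i using graded_mapD(1)[OF 2] .
  show "D 0 \<in> carrier_mat 1 (length (F 0))" using graded_mapD(1)[OF 1] by simp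
  show "Poly_Mapping.lookup (D (Suc i) $$ (r, c)) 0 = 0" if "r < length (F i)" "c < length (F (Suc i))" for i r c
    using assms that 3[of i] unfolding minimal_graded_free_resolution_def by auto
qed (use assms in \<open>simp_all add: minimal_graded_free_resolution_def\<close>)

lemma resolution_complex:
  assumes "minimal_graded_free_resolution F D I"
  shows "D 0 * D (Suc 0) = 0\<^sub>m 1 (length (F (Suc 0)))"
    "\<And>i. D (Suc i) * D (Suc (Suc i)) = 0\<^sub>m (length (F i)) (length (F (Suc (Suc i))))"
  using exact_imp_complex resolution_maps[OF assms] by metis+

section \<open>Uniqueness of graded Betti numbers\<close>

text \<open>Both matrices are padded with zeros to square matrices. If the middle index set were the smaller
  one, then the product in the other order would have a zero row, although one-sided inverses of
  square matrices over a field are two-sided.\<close>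

lemma card_le_of_left_inverse:
  fixes a b :: "'i \<Rightarrow> 'j \<Rightarrow> 'k::field"
  assumes "finite S" "finite T"
    and inv: "\<And>c c'. c \<in> S \<Longrightarrow> c' \<in> S \<Longrightarrow> (\<Sum>r\<in>T. b c r * a c' r) = (if c = c' then 1 else 0)"
  shows "card S \<le> card T"
proof (rule ccontr)
  assume "\<not> card S \<le> card T"
  define n m where "n = card S" and "m = card T"
  have mn: "m < n" using \<open>\<not> card S \<le> card T\<close> by (simp add: n_def m_def)
  obtain f where f: "bij_betw f {0..<n} S" using ex_bij_betw_nat_finite[OF assms(1)] by (auto simp: n_def)
  obtain g where g: "bij_betw g {0..<m} T" using ex_bij_betw_nat_finite[OF assms(2)] by (auto simp: m_def)
  define A where "A = mat n n (\<lambda>(i, j). if i < m then a (f j) (g i) else 0)"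
  define B where "B = mat n n (\<lambda>(i, j). if j < m then b (f i) (g j) else 0)"
  have "(B * A) $$ (i, j) = (if i = j then 1 else 0)" if "i < n" "j < n" for i j
  proof -
    have "(B * A) $$ (i, j) = (\<Sum>k = 0..<n. B $$ (i, k) * A $$ (k, j))"
      using that by (simp add: A_def B_def scalar_prod_def)
    also have "\<dots> = (\<Sum>k = 0..<n. (if k < m then b (f i) (g k) * a (f j) (g k) else 0))"
      by (rule sum.cong) (use that in \<open>auto simp: A_def B_def\<close>)
    also have "\<dots> = (\<Sum>k\<in>{0..<m}. b (f i) (g k) * a (f j) (g k))"
      using mn by (intro sum.mono_neutral_cong_right) auto
    also have "\<dots> = (\<Sum>r\<in>T. b (f i) r * a (f j) r)"
      using g by (rule sum.reindex_bij_betw)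
    also have "\<dots> = (if f i = f j then 1 else 0)"
      using that f by (intro inv) (auto simp: bij_betw_def)
    also have "f i = f j \<longleftrightarrow> i = j"
      using that f by (auto simp: bij_betw_def inj_on_def)
    finally show ?thesis .
  qed
  then have "B * A = 1\<^sub>m n" by (intro eq_matI) (auto simp: A_def B_def)
  then have "A * B = 1\<^sub>m n"
    by (rule mat_mult_left_right_inverse[rotated 2]) (auto simp: A_def B_def)
  then have "(A * B) $$ (m, m) = 1" using mn by simp
  moreover have "(A * B) $$ (m, m) = 0" using mn by (simp add: A_def B_def scalar_prod_def)
  ultimately show False by simp
qed

lemma count_mset_card: "count (mset xs) j = card {i. i < length xs \<and> xs ! i = j}"
  by (auto simp: count_mset count_list_eq_length_filter length_filter_conv_card intro!: arg_cong[of _ _ card])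

lemma const_term_mat_mult:
  fixes M N :: "'k::comm_ring_1 poly3 mat"
  assumes "M \<in> carrier_mat n m" "N \<in> carrier_mat m p" "r < n" "c < p"
  shows "Poly_Mapping.lookup ((M * N) $$ (r, c)) 0 =
    (\<Sum>j<m. Poly_Mapping.lookup (M $$ (r, j)) 0 * Poly_Mapping.lookup (N $$ (j, c)) 0)"
  using assms by (simp add: scalar_prod_def lookup_sum const_term_mult atLeast0LessThan)

text \<open>The image of a one-row matrix consists of vectors of length one and is determined by the ideal of
  their entries. Two resolutions of one ideal have different augmentation matrices, and only their
  ideals agree.\<close>

lemma mat_image_one_row:
  fixes M :: "'k::comm_ring_1 poly3 mat"
  assumes "M \<in> carrier_mat 1 n"
  shows "w \<in> mat_image M \<longleftrightarrow> w \<in> carrier_vec 1 \<and> w $ 0 \<in> (\<lambda>v. v $ 0) ` mat_image M"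
proof
  assume "w \<in> mat_image M"
  moreover have "w \<in> carrier_vec 1" using \<open>w \<in> mat_image M\<close> assms by (auto simp: mat_image_def)
  ultimately show "w \<in> carrier_vec 1 \<and> w $ 0 \<in> (\<lambda>v. v $ 0) ` mat_image M" by blast
next
  assume w: "w \<in> carrier_vec 1 \<and> w $ 0 \<in> (\<lambda>v. v $ 0) ` mat_image M"
  then obtain v where v: "v \<in> mat_image M" "w $ 0 = v $ 0" by blast
  then have "v \<in> carrier_vec 1" using assms by (auto simp: mat_image_def)
  then have "w = v" using v w by (intro eq_vecI) auto
  with v show "w \<in> mat_image M" by simp
qed

text \<open>The identity of the ideal is lifted step by step along the exact complex \<open>D'\<close>.\<close>

lemma comparison_maps:
  fixes D D' :: "nat \<Rightarrow> 'k::comm_ring_1 poly3 mat"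
  assumes R: "minimal_graded_free_resolution F D I" and R': "minimal_graded_free_resolution F' D' I"
  shows "\<exists>A. (\<forall>i. graded_map (F i) (F' i) (A i)) \<and> D' 0 * A 0 = D 0 \<and>
    (\<forall>i. D' (Suc i) * A (Suc i) = A i * D (Suc i))"
proof -
  note r = resolution_maps[OF R] and r' = resolution_maps[OF R']
  \<comment> \<open>The invariant keeps \<open>A * D (Suc i)\<close> in the kernel of \<open>D' i\<close>, which is what the next lifting needs.\<close>
  define P where "P i A \<longleftrightarrow> graded_map (F i) (F' i) A \<and> (i = 0 \<longrightarrow> D' 0 * A = D 0) \<and>
    D' i * (A * D (Suc i)) = 0\<^sub>m (dim_row (D' i)) (length (F (Suc i)))" for i A
  have "\<exists>A. P 0 A"
  proof -
    have "col (D 0) j \<in> mat_image (D' 0)" if "j < length (F 0)" for j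
    proof -
      have "D 0 *\<^sub>v unit_vec (length (F 0)) j = col (D 0) j"
        by (metis col_mult2[OF r(5) one_carrier_mat that] right_mult_one_mat[OF r(5)] col_one[OF that])
      then have "col (D 0) j \<in> mat_image (D 0)"
        using r(5) by (auto simp: mat_image_def intro!: exI[of _ "unit_vec (length (F 0)) j"])
      then show ?thesis
        using mat_image_one_row[OF r(5)] mat_image_one_row[OF r'(5)] r(7) r'(7) by blast
    qed
    from graded_lift_image[OF r'(1) r(1) this] obtain A where
      A: "graded_map (F 0) (F' 0) A" "D' 0 * A = D 0" by metis
    then have "P 0 A"
      unfolding P_def using resolution_complex(1)[OF R] r(4)[of 0] r'(5)
        assoc_mult_mat[OF r'(5) graded_mapD(1)[OF A(1)] r(4)[of 0]] by simp
    then show ?thesis by blast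
  qed
  moreover have "\<exists>B. P (Suc i) B \<and> D' (Suc i) * B = A * D (Suc i)" if "P i A" for A i
  proof -
    have A: "graded_map (F i) (F' i) A" "D' i * (A * D (Suc i)) = 0\<^sub>m (dim_row (D' i)) (length (F (Suc i)))"
      using that by (auto simp: P_def)
    have t: "graded_map (F' i) (target_shifts F' i) (D' i)"
      using R' by (simp add: minimal_graded_free_resolution_def)
    have "D' i * (A * D (Suc i)) = 0\<^sub>m (length (target_shifts F' i)) (length (F (Suc i)))"
      using A(2) graded_mapD(1)[OF t] by simp
    from graded_lift_kernel[OF t r'(2) r'(3) graded_map_mult[OF A(1) r(2)] this]
    obtain B where B: "graded_map (F (Suc i)) (F' (Suc i)) B" "D' (Suc i) * B = A * D (Suc i)" by blast
    have "D' (Suc i) * (B * D (Suc (Suc i))) = A * (D (Suc i) * D (Suc (Suc i)))"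
      using B(2) assoc_mult_mat[OF r'(4) graded_mapD(1)[OF B(1)] r(4)]
        assoc_mult_mat[OF graded_mapD(1)[OF A(1)] r(4) r(4)] by simp
    also have "\<dots> = 0\<^sub>m (dim_row (D' (Suc i))) (length (F (Suc (Suc i))))"
      unfolding resolution_complex(2)[OF R] using graded_mapD(1)[OF A(1)] r'(4)[of i] by simp
    finally show ?thesis using B by (auto simp: P_def)
  qed
  ultimately obtain A where A: "\<And>i. P i (A i) \<and> D' (Suc i) * A (Suc i) = A i * D (Suc i)"
    using dependent_nat_choice[of P "\<lambda>i A B. D' (Suc i) * B = A * D (Suc i)"] by blast
  show ?thesis
    by (rule exI[of _ A]) (use A in \<open>auto simp: P_def\<close>)
qed

text \<open>An endomorphism of a resolution that lifts the identity is homotopic to the identity. Both terms of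
  the homotopy contain a differential, whose entries have no constant terms by minimality. Hence the
  endomorphism is the identity modulo \<open>(x, y, z)\<close>.\<close>

lemma chain_endomorphism_unit:
  fixes D :: "nat \<Rightarrow> 'k::comm_ring_1 poly3 mat"
  assumes R: "minimal_graded_free_resolution F D I"
    and C: "\<And>i. C i \<in> carrier_mat (length (F i)) (length (F i))"
    and C0: "D 0 * C 0 = D 0" and CS: "\<And>i. D (Suc i) * C (Suc i) = C i * D (Suc i)"
    and rc: "r < length (F i)" "c < length (F i)"
  shows "Poly_Mapping.lookup (C i $$ (r, c)) 0 = (if r = c then 1 else 0)"
proof -
  note D = resolution_maps(4,5)[OF R]
  let ?n = "\<lambda>i. length (F i)"
  have const: "\<forall>r<?n i. \<forall>c<?n i. Poly_Mapping.lookup (M $$ (r, c)) 0 = (0::'k)"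
    if "M = D (Suc i) * h" "h \<in> carrier_mat (?n (Suc i)) (?n i)" for M h i
    using that const_term_mat_mult[OF D(1)[of i] that(2)] resolution_maps(6)[OF R] by simp
  have const': "\<forall>r<?n (Suc i). \<forall>c<?n (Suc i). Poly_Mapping.lookup (M $$ (r, c)) 0 = (0::'k)"
    if "M = h * D (Suc i)" "h \<in> carrier_mat (?n (Suc i)) (?n i)" for M h i
    using that const_term_mat_mult[OF that(2) D(1)[of i]] resolution_maps(6)[OF R] by simp
  \<comment> \<open>The second conjunct remembers of the homotopy only what is needed to construct its next component.\<close>
  have "(\<forall>r<?n i. \<forall>c<?n i. Poly_Mapping.lookup ((C i - 1\<^sub>m (?n i)) $$ (r, c)) 0 = 0) \<and>
     (\<exists>h. h \<in> carrier_mat (?n (Suc i)) (?n i) \<and>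
       (C i - 1\<^sub>m (?n i)) * D (Suc i) = D (Suc i) * h * D (Suc i))" for i
  proof (induction i)
    case 0
    have "D 0 * (C 0 - 1\<^sub>m (?n 0)) = 0\<^sub>m 1 (?n 0)"
      using mult_minus_distrib_mat[OF D(2) C[of 0] one_carrier_mat] C0 D(2) by auto
    then obtain h where h: "h \<in> carrier_mat (?n (Suc 0)) (?n 0)" "D (Suc 0) * h = C 0 - 1\<^sub>m (?n 0)"
      by (rule lift_kernel[OF D(2) D(1)[of 0] resolution_maps(3)[OF R], rotated])
         (use C[of 0] in auto)
    then show ?case using const[OF h(2)[symmetric] h(1)] by metis
  next
    case (Suc i)
    then obtain h where h: "h \<in> carrier_mat (?n (Suc i)) (?n i)"
      "(C i - 1\<^sub>m (?n i)) * D (Suc i) = D (Suc i) * h * D (Suc i)" by blast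
    let ?E = "C (Suc i) - 1\<^sub>m (?n (Suc i))"
    have E: "?E \<in> carrier_mat (?n (Suc i)) (?n (Suc i))" using C by auto
    have hD: "h * D (Suc i) \<in> carrier_mat (?n (Suc i)) (?n (Suc i))" using h D(1)[of i] by auto
    have "D (Suc i) * ?E = (C i - 1\<^sub>m (?n i)) * D (Suc i)"
      using mult_minus_distrib_mat[OF D(1)[of i] C[of "Suc i"] one_carrier_mat]
        minus_mult_distrib_mat[OF C[of i] one_carrier_mat D(1)[of i]] CS[of i] D(1)[of i] by simp
    also have "\<dots> = D (Suc i) * (h * D (Suc i))"
      using h(2) assoc_mult_mat[OF D(1) h(1) D(1)] by simp
    finally have "D (Suc i) * (?E - h * D (Suc i)) = 0\<^sub>m (?n i) (?n (Suc i))"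
      using mult_minus_distrib_mat[OF D(1)[of i] E hD] D(1)[of i] hD by auto
    then obtain k where k: "k \<in> carrier_mat (?n (Suc (Suc i))) (?n (Suc i))"
        "D (Suc (Suc i)) * k = ?E - h * D (Suc i)"
      by (rule lift_kernel[OF D(1)[of i] D(1)[of "Suc i"] resolution_maps(3)[OF R], rotated])
         (use minus_carrier_mat[OF hD] in auto)
    have Dk: "D (Suc (Suc i)) * k \<in> carrier_mat (?n (Suc i)) (?n (Suc i))" using k(1) D(1)[of "Suc i"] by auto
    have Eeq: "?E = D (Suc (Suc i)) * k + h * D (Suc i)"
      using E hD unfolding k(2) by (intro eq_matI) auto
    have "?E * D (Suc (Suc i)) = D (Suc (Suc i)) * k * D (Suc (Suc i)) + h * D (Suc i) * D (Suc (Suc i))"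
      unfolding Eeq by (rule add_mult_distrib_mat[OF Dk hD D(1)])
    also have "h * D (Suc i) * D (Suc (Suc i)) = 0\<^sub>m (?n (Suc i)) (?n (Suc (Suc i)))"
      unfolding assoc_mult_mat[OF h(1) D(1) D(1)] resolution_complex(2)[OF R] using h(1) by simp
    also have "D (Suc (Suc i)) * k * D (Suc (Suc i)) + 0\<^sub>m (?n (Suc i)) (?n (Suc (Suc i))) =
       D (Suc (Suc i)) * k * D (Suc (Suc i))"
      using Dk D(1)[of "Suc i"] by (intro right_add_zero_mat) auto
    finally have "?E * D (Suc (Suc i)) = D (Suc (Suc i)) * k * D (Suc (Suc i))" .
    moreover have "\<forall>r<?n (Suc i). \<forall>c<?n (Suc i). Poly_Mapping.lookup (?E $$ (r, c)) 0 = (0::'k)"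
    proof (intro allI impI)
      fix r c assume rc: "r < ?n (Suc i)" "c < ?n (Suc i)"
      have "?E $$ (r, c) = (D (Suc (Suc i)) * k) $$ (r, c) + (h * D (Suc i)) $$ (r, c)"
        unfolding Eeq using rc carrier_matD[OF hD] by (intro index_add_mat(1)) simp_all
      then show "Poly_Mapping.lookup (?E $$ (r, c)) 0 = (0::'k)"
        using const[OF refl k(1), rule_format, OF rc] const'[OF refl h(1), rule_format, OF rc]
        by (simp only: lookup_add add_0)
    qed
    ultimately show ?case using k(1) by blast
  qed
  then have "Poly_Mapping.lookup ((C i - 1\<^sub>m (?n i)) $$ (r, c)) 0 = 0" using rc by blast
  then show ?thesis using rc C[of i] by (auto simp: lookup_minus split: if_splits)
qed

text \<open>The composite of the two comparison maps is the identity modulo \<open>(x, y, z)\<close>. A constant entry of a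
  graded matrix joins two equal shifts, so the identity splits into one block for each shift \<open>j\<close>.\<close>

lemma minimal_resolution_count_le:
  fixes D D' :: "nat \<Rightarrow> 'k::field poly3 mat"
  assumes R: "minimal_graded_free_resolution F D I" and R': "minimal_graded_free_resolution F' D' I"
  shows "count (mset (F i)) j \<le> count (mset (F' i)) j"
proof -
  note r = resolution_maps[OF R] and r' = resolution_maps[OF R']
  obtain A :: "nat \<Rightarrow> 'k poly3 mat" where A: "\<And>i. graded_map (F i) (F' i) (A i)" "D' 0 * A 0 = D 0"
    "\<And>i. D' (Suc i) * A (Suc i) = A i * D (Suc i)"
    using comparison_maps[OF R R'] by blast
  obtain B :: "nat \<Rightarrow> 'k poly3 mat" where B: "\<And>i. graded_map (F' i) (F i) (B i)" "D 0 * B 0 = D' 0"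
    "\<And>i. D (Suc i) * B (Suc i) = B i * D' (Suc i)"
    using comparison_maps[OF R' R] by blast
  note Ac = graded_mapD(1)[OF A(1)] and Bc = graded_mapD(1)[OF B(1)]
  let ?a = "\<lambda>c r. Poly_Mapping.lookup (A i $$ (r, c)) 0" and ?b = "\<lambda>c r. Poly_Mapping.lookup (B i $$ (c, r)) 0"
  let ?S = "{c. c < length (F i) \<and> F i ! c = j}" and ?T = "{r. r < length (F' i) \<and> F' i ! r = j}"
  have "card ?S \<le> card ?T"
  proof (rule card_le_of_left_inverse[of _ _ ?b ?a])
    fix c c' assume c: "c \<in> ?S" "c' \<in> ?S"
    have "(\<Sum>r\<in>?T. ?b c r * ?a c' r) = (\<Sum>r<length (F' i). ?b c r * ?a c' r)"
    proof (rule sum.mono_neutral_left)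
      show "\<forall>r\<in>{..<length (F' i)} - ?T. ?b c r * ?a c' r = 0"
      proof
        fix r assume "r \<in> {..<length (F' i)} - ?T"
        then have "homogeneous_of_degree (F' i ! r - j) (B i $$ (c, r))" "F' i ! r - j \<noteq> 0"
          using graded_mapD(2)[OF B(1), of c i r] c by auto
        then show "?b c r * ?a c' r = 0" by (simp add: homogeneous_const_term_0)
      qed
    qed auto
    also have "\<dots> = Poly_Mapping.lookup ((B i * A i) $$ (c, c')) 0"
      using c by (subst const_term_mat_mult[OF Bc Ac]) auto
    also have "\<dots> = (if c = c' then 1 else 0)"
    proof (rule chain_endomorphism_unit[OF R])
      show "B i * A i \<in> carrier_mat (length (F i)) (length (F i))" for i
        using Ac[of i] Bc[of i] by auto
      show "D 0 * (B 0 * A 0) = D 0"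
        using assoc_mult_mat[OF r(5) Bc Ac] A(2) B(2) by simp
      show "D (Suc i) * (B (Suc i) * A (Suc i)) = B i * A i * D (Suc i)" for i
        using assoc_mult_mat[OF r(4)[of i] Bc Ac] A(3)[of i] B(3)[of i]
          assoc_mult_mat[OF Bc[of i] r'(4)[of i] Ac] assoc_mult_mat[OF Bc[of i] Ac[of i] r(4)[of i]] by simp
    qed (use c in auto)
    finally show "(\<Sum>r\<in>?T. ?b c r * ?a c' r) = (if c = c' then 1 else 0)" .
  qed auto
  then show ?thesis by (simp add: count_mset_card)
qed

theorem minimal_resolution_shifts_unique:
  fixes D D' :: "nat \<Rightarrow> 'k::field poly3 mat"
  assumes "minimal_graded_free_resolution F D I" "minimal_graded_free_resolution F' D' I"
  shows "mset (F i) = mset (F' i)"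
  using minimal_resolution_count_le[OF assms] minimal_resolution_count_le[OF assms(2,1)]
  by (intro multiset_eqI order_antisym)

lemma graded_betti_eq:
  fixes D :: "nat \<Rightarrow> 'k::field poly3 mat"
  assumes "minimal_graded_free_resolution F D I"
  shows "graded_betti I i j = count (mset (F i)) j"
  unfolding graded_betti_def
proof (rule the_equality)
  show "\<exists>F' D'. minimal_graded_free_resolution F' D' I \<and> count (mset (F i)) j = count (mset (F' i)) j"
    using assms by blast
next
  fix n assume "\<exists>F' D'. minimal_graded_free_resolution F' D' I \<and> n = count (mset (F' i)) j"
  then show "n = count (mset (F i)) j"
    using minimal_resolution_shifts_unique[OF _ assms] by metis
qed

section \<open>Null-homotopic multiplications and the sum of the shifts\<close>

text \<open>The first differential has one row; the dimension \<open>1\<close> has to stay in this form for carrier sets to match.\<close>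

declare One_nat_def [simp del]
declare minus_carrier_mat [simp] right_mult_one_mat' [simp] left_mult_one_mat' [simp]

lemma mult_scalar_mat:
  fixes M :: "'a::comm_ring_1 mat"
  assumes "M \<in> carrier_mat n m"
  shows "(g \<cdot>\<^sub>m 1\<^sub>m n) * M = g \<cdot>\<^sub>m M" "M * (g \<cdot>\<^sub>m 1\<^sub>m m) = g \<cdot>\<^sub>m M"
  using mult_smult_assoc_mat[OF one_carrier_mat assms, of g] mult_smult_distrib[OF assms one_carrier_mat, of g] assms
  by simp_all

lemma minus_eq_0_mat:
  fixes A B :: "'a::comm_ring_1 mat"
  assumes "A \<in> carrier_mat n m" "B \<in> carrier_mat n m" "A - B = 0\<^sub>m n m"
  shows "A = B"
proof (rule eq_matI)
  fix i j assume ij: "i < dim_row B" "j < dim_col B"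
  then have "(A - B) $$ (i, j) = 0" using assms by simp
  then show "A $$ (i, j) = B $$ (i, j)" using ij by simp
qed (use assms in auto)

lemma minus_eq_imp_add:
  fixes A B C :: "'a::comm_ring_1 mat"
  assumes "A \<in> carrier_mat n m" "B \<in> carrier_mat n m" "C = A - B"
  shows "B + C = A" "C + B = A"
  using assms by (auto intro!: eq_matI)

text \<open>
  A graded free resolution of length two of an ideal, with the shifts \<open>a\<close>, \<open>b\<close> and \<open>c\<close> of its three
  modules. The zero module in the next place is expressed by the injectivity of \<open>D2\<close>.
\<close>

locale short_resolution =
  fixes a b c :: "int list" and D0 D1 D2 :: "'k::field poly3 mat"
  assumes D0: "graded_map a [0] D0" and D1: "graded_map b a D1" and D2: "graded_map c b D2"
    and exact0: "mat_kernel D0 = mat_image D1" and exact1: "mat_kernel D1 = mat_image D2"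
    and inj2: "mat_kernel D2 = {0\<^sub>v (length c)}"
begin

abbreviation "na \<equiv> length a"
abbreviation "nb \<equiv> length b"
abbreviation "nc \<equiv> length c"

lemma carriers [simp]:
  "D0 \<in> carrier_mat 1 na" "D1 \<in> carrier_mat na nb" "D2 \<in> carrier_mat nb nc"
  using graded_mapD(1)[OF D0] graded_mapD(1)[OF D1] graded_mapD(1)[OF D2] by (simp_all add: One_nat_def)

lemma dims [simp]:
  "dim_row D0 = 1" "dim_col D0 = na" "dim_row D1 = na" "dim_col D1 = nb" "dim_row D2 = nb" "dim_col D2 = nc"
  using carriers by (auto simp del: carriers)

lemma complex [simp]: "D0 * D1 = 0\<^sub>m 1 nb" "D1 * D2 = 0\<^sub>m na nc"
  using exact_imp_complex exact0 exact1 carriers by blast+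

definition ideal :: "'k poly3 set"
  where "ideal = (\<lambda>v. v $ 0) ` mat_image D0"

text \<open>Homotopies between zero and multiplication by \<open>g\<close> on the resolution
  \<open>0 \<rightarrow> F2 \<rightarrow> F1 \<rightarrow> F0 \<rightarrow> R\<close> of \<open>R/I\<close>.\<close>

definition homotopy :: "'k poly3 \<Rightarrow> 'k poly3 mat \<Rightarrow> 'k poly3 mat \<Rightarrow> 'k poly3 mat \<Rightarrow> bool"
  where "homotopy g h0 h1 h2 \<longleftrightarrow>
    h0 \<in> carrier_mat na 1 \<and> h1 \<in> carrier_mat nb na \<and> h2 \<in> carrier_mat nc nb \<and>
    D0 * h0 = g \<cdot>\<^sub>m 1\<^sub>m 1 \<and> h0 * D0 + D1 * h1 = g \<cdot>\<^sub>m 1\<^sub>m na \<and>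
    h1 * D1 + D2 * h2 = g \<cdot>\<^sub>m 1\<^sub>m nb \<and> h2 * D2 = g \<cdot>\<^sub>m 1\<^sub>m nc"

lemma inj2_mat:
  assumes "G \<in> carrier_mat nc p" "D2 * G = 0\<^sub>m nb p"
  shows "G = 0\<^sub>m nc p"
proof (rule mat_col_eqI)
  fix j assume "j < dim_col (0\<^sub>m nc p)"
  then show "col G j = col (0\<^sub>m nc p) j"
    using cols_in_mat_kernel[OF carriers(3) assms] inj2 by simp
qed (use assms in auto)

text \<open>Multiplication by \<open>g\<close> is zero on \<open>R/I\<close>; each component is a lift of what the previous ones leave
  over. The last equation follows from the injectivity of \<open>D2\<close>.\<close>

lemma homotopy_exists:
  assumes g: "g \<in> ideal" and hom: "homogeneous_of_degree s g"
  obtains h0 h1 h2 where "homotopy g h0 h1 h2" "graded_map (map ((+) s) a) b h1"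
proof -
  have "col (g \<cdot>\<^sub>m 1\<^sub>m 1) j \<in> mat_image D0" if "j < length [s]" for j
    unfolding mat_image_one_row[OF carriers(1)] using g that by (auto simp: ideal_def)
  moreover have g0: "graded_map [s] [0] (g \<cdot>\<^sub>m 1\<^sub>m 1)" using hom by (simp add: graded_map_def One_nat_def)
  ultimately obtain h0 where h0: "graded_map [s] a h0" "D0 * h0 = g \<cdot>\<^sub>m 1\<^sub>m 1"
    using graded_lift_image[OF D0, of "[s]" "g \<cdot>\<^sub>m 1\<^sub>m 1"] by blast
  have h0c: "h0 \<in> carrier_mat na 1" using graded_mapD(1)[OF h0(1)] by (simp add: One_nat_def)
  have c0: "h0 * D0 \<in> carrier_mat na na" using h0c carriers(1) by (rule mult_carrier_mat)
  have "graded_map (map ((+) s) a) a (h0 * D0)"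
    using graded_map_mult[OF h0(1), of "map ((+) s) a" D0] graded_map_shift[OF D0, of s] by simp
  then have G1: "graded_map (map ((+) s) a) a (g \<cdot>\<^sub>m 1\<^sub>m na - h0 * D0)"
    by (intro graded_map_minus graded_map_scalar hom)
  have "D0 * (g \<cdot>\<^sub>m 1\<^sub>m na - h0 * D0) = g \<cdot>\<^sub>m D0 - D0 * h0 * D0"
    using mult_minus_distrib_mat[OF carriers(1) _ c0] mult_scalar_mat[OF carriers(1)]
      assoc_mult_mat[OF carriers(1) h0c carriers(1)] by auto
  also have "\<dots> = 0\<^sub>m 1 na" unfolding h0(2) mult_scalar_mat[OF carriers(1)] using carriers(1) by auto
  finally obtain h1 where h1: "graded_map (map ((+) s) a) b h1" "D1 * h1 = g \<cdot>\<^sub>m 1\<^sub>m na - h0 * D0"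
    using graded_lift_kernel[OF D0 D1 exact0 G1] by (auto simp: One_nat_def)
  have h1c: "h1 \<in> carrier_mat nb na" using graded_mapD(1)[OF h1(1)] by simp
  have c1: "h1 * D1 \<in> carrier_mat nb nb" using h1c carriers(2) by (rule mult_carrier_mat)
  have "D1 * (g \<cdot>\<^sub>m 1\<^sub>m nb - h1 * D1) = g \<cdot>\<^sub>m D1 - D1 * h1 * D1"
    using mult_minus_distrib_mat[OF carriers(2) _ c1] mult_scalar_mat[OF carriers(2)]
      assoc_mult_mat[OF carriers(2) h1c carriers(2)] by auto
  also have "D1 * h1 * D1 = g \<cdot>\<^sub>m D1 - h0 * (D0 * D1)"
    unfolding h1(2) using minus_mult_distrib_mat[OF _ c0 carriers(2)] mult_scalar_mat[OF carriers(2)]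
      assoc_mult_mat[OF h0c carriers(1) carriers(2)] by auto
  also have "g \<cdot>\<^sub>m D1 - \<dots> = 0\<^sub>m na nb" using h0c carriers(2) by auto
  finally obtain h2 where h2: "h2 \<in> carrier_mat nc nb" "D2 * h2 = g \<cdot>\<^sub>m 1\<^sub>m nb - h1 * D1"
    using lift_kernel[OF carriers(2,3) exact1, where p = nb and G = "g \<cdot>\<^sub>m 1\<^sub>m nb - h1 * D1"] c1 by auto
  have c2: "h2 * D2 \<in> carrier_mat nc nc" using h2(1) carriers(3) by (rule mult_carrier_mat)
  have "D2 * (h2 * D2 - g \<cdot>\<^sub>m 1\<^sub>m nc) = D2 * h2 * D2 - g \<cdot>\<^sub>m D2"
    using mult_minus_distrib_mat[OF carriers(3) c2] mult_scalar_mat[OF carriers(3)]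
      assoc_mult_mat[OF carriers(3) h2(1) carriers(3)] by auto
  also have "D2 * h2 * D2 = g \<cdot>\<^sub>m D2 - h1 * (D1 * D2)"
    unfolding h2(2) using minus_mult_distrib_mat[OF _ c1 carriers(3)] mult_scalar_mat[OF carriers(3)]
      assoc_mult_mat[OF h1c carriers(2) carriers(3)] by auto
  also have "\<dots> - g \<cdot>\<^sub>m D2 = 0\<^sub>m nb nc" using h1c carriers(3) by auto
  finally have "h2 * D2 - g \<cdot>\<^sub>m 1\<^sub>m nc = 0\<^sub>m nc nc"
    using c2 by (intro inj2_mat) auto
  then have e2: "h2 * D2 = g \<cdot>\<^sub>m 1\<^sub>m nc"
    by (intro minus_eq_0_mat[OF c2]) auto
  have "homotopy g h0 h1 h2"
    unfolding homotopy_def using h0c h1c h2(1) h0(2) e2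
      minus_eq_imp_add(1)[OF _ c0 h1(2)] minus_eq_imp_add(1)[OF _ c1 h2(2)] by auto
  with h1(1) that show thesis by blast
qed

text \<open>The differentials \<open>D0\<close>, \<open>D2\<close> and the middle homotopy form a map \<open>F0 \<oplus> F2 \<rightarrow> R \<oplus> F1\<close>
  between free modules of equal rank.\<close>

definition glued :: "'k poly3 mat \<Rightarrow> 'k poly3 mat"
  where "glued h1 = four_block_mat D0 (0\<^sub>m 1 nc) h1 D2"

lemma glued_carrier: "h1 \<in> carrier_mat nb na \<Longrightarrow> glued h1 \<in> carrier_mat (1 + nb) (na + nc)"
  unfolding glued_def by (rule four_block_carrier_mat) auto

text \<open>The remaining maps \<open>h0\<close>, \<open>D1\<close> and \<open>h2\<close> form a map in the other direction. By the homotopy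
  equations the composite is block triangular with \<open>g\<close> on the diagonal.\<close>

lemma glued_det_dvd:
  assumes "homotopy g h0 h1 h2" and rank: "na + nc = 1 + nb"
  shows "\<exists>q. det (glued h1) * q = g ^ (1 + nb)"
proof -
  have c: "h0 \<in> carrier_mat na 1" "h1 \<in> carrier_mat nb na" "h2 \<in> carrier_mat nc nb"
    and e: "D0 * h0 = g \<cdot>\<^sub>m 1\<^sub>m 1" "h1 * D1 + D2 * h2 = g \<cdot>\<^sub>m 1\<^sub>m nb"
    using assms(1) by (auto simp: homotopy_def)
  let ?P = "four_block_mat h0 D1 (0\<^sub>m nc 1) h2"
  have P: "?P \<in> carrier_mat (na + nc) (1 + nb)" using c by (intro four_block_carrier_mat) auto
  have "glued h1 * ?P = four_block_mat (D0 * h0 + 0\<^sub>m 1 nc * 0\<^sub>m nc 1) (D0 * D1 + 0\<^sub>m 1 nc * h2)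
      (h1 * h0 + D2 * 0\<^sub>m nc 1) (h1 * D1 + D2 * h2)"
    unfolding glued_def by (rule mult_four_block_mat) (use c in auto)
  also have "\<dots> = four_block_mat (g \<cdot>\<^sub>m 1\<^sub>m 1) (0\<^sub>m 1 nb) (h1 * h0 + D2 * 0\<^sub>m nc 1) (g \<cdot>\<^sub>m 1\<^sub>m nb)"
    unfolding e complex using c by simp
  finally have "det (glued h1 * ?P) = det (g \<cdot>\<^sub>m 1\<^sub>m 1) * det (g \<cdot>\<^sub>m 1\<^sub>m nb)"
    by (simp only:) (rule det_four_block_mat_upper_right_zero, use c carriers(3) in auto)
  also have "\<dots> = g ^ (1 + nb)" by (simp add: power_add)
  finally show ?thesis
    using det_mult[of "glued h1" "1 + nb" ?P] glued_carrier[OF c(2)] P rank by auto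
qed

text \<open>Two homotopies for the same multiplier differ by a second-order homotopy \<open>(k0, k1)\<close>. It
  transforms one glued matrix into the other by unipotent row and column operations.\<close>

lemma glued_det_unique:
  assumes h: "homotopy g h0 h1 h2" and h': "homotopy g h0' h1' h2'" and rank: "na + nc = 1 + nb"
  shows "det (glued h1) = det (glued h1')"
proof -
  have c: "h0 \<in> carrier_mat na 1" "h1 \<in> carrier_mat nb na" "h2 \<in> carrier_mat nc nb"
    and e: "D0 * h0 = g \<cdot>\<^sub>m 1\<^sub>m 1" "h0 * D0 + D1 * h1 = g \<cdot>\<^sub>m 1\<^sub>m na"
    using h by (auto simp: homotopy_def)
  have c': "h0' \<in> carrier_mat na 1" "h1' \<in> carrier_mat nb na" "h2' \<in> carrier_mat nc nb"
    and e': "D0 * h0' = g \<cdot>\<^sub>m 1\<^sub>m 1" "h0' * D0 + D1 * h1' = g \<cdot>\<^sub>m 1\<^sub>m na"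
    using h' by (auto simp: homotopy_def)
  have "D0 * (h0 - h0') = 0\<^sub>m 1 1"
    using mult_minus_distrib_mat[OF carriers(1) c(1) c'(1)] e e' by auto
  then obtain k0 where k0: "k0 \<in> carrier_mat nb 1" "D1 * k0 = h0 - h0'"
    using lift_kernel[OF carriers(1,2) exact0, where p = 1 and G = "h0 - h0'"] c c' by auto
  have kD: "k0 * D0 \<in> carrier_mat nb na" using k0(1) carriers(1) by (rule mult_carrier_mat)
  have hh: "h1 - h1' \<in> carrier_mat nb na" using c c' by auto
  have "D1 * (h1 - h1' + k0 * D0) = D1 * h1 - D1 * h1' + (h0 * D0 - h0' * D0)"
    using mult_add_distrib_mat[OF carriers(2) hh kD] mult_minus_distrib_mat[OF carriers(2) c(2) c'(2)]
      assoc_mult_mat[OF carriers(2) k0(1) carriers(1)] k0(2) minus_mult_distrib_mat[OF c(1) c'(1) carriers(1)]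
    by simp
  also have "\<dots> = 0\<^sub>m na na"
  proof (rule eq_matI)
    fix i j assume ij: "i < dim_row (0\<^sub>m na na)" "j < dim_col (0\<^sub>m na na)"
    have "(h0 * D0) $$ (i, j) + (D1 * h1) $$ (i, j) = (h0' * D0) $$ (i, j) + (D1 * h1') $$ (i, j)"
      using arg_cong[OF e(2)[folded e'(2)], of "\<lambda>M. M $$ (i, j)"] ij c[THEN carrier_matD(1)] c'[THEN carrier_matD(1)]
        c[THEN carrier_matD(2)] c'[THEN carrier_matD(2)]
      by (simp del: index_mult_mat(1))
    then show "(D1 * h1 - D1 * h1' + (h0 * D0 - h0' * D0)) $$ (i, j) = 0\<^sub>m na na $$ (i, j)"
      using ij c[THEN carrier_matD(1)] c'[THEN carrier_matD(1)] c[THEN carrier_matD(2)] c'[THEN carrier_matD(2)]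
      by (simp del: index_mult_mat(1) add: algebra_simps)
  qed (use c c' carriers in auto)
  finally obtain k1 where k1: "k1 \<in> carrier_mat nc na" "D2 * k1 = h1 - h1' + k0 * D0"
    using lift_kernel[OF carriers(2,3) exact1, where p = na and G = "h1 - h1' + k0 * D0"] hh kD by auto
  \<comment> \<open>The row and column operations given by \<open>k0\<close> and \<open>k1\<close>.\<close>
  let ?L = "four_block_mat (1\<^sub>m 1) (0\<^sub>m 1 nb) (- k0) (1\<^sub>m nb)"
  let ?R = "four_block_mat (1\<^sub>m na) (0\<^sub>m na nc) k1 (1\<^sub>m nc)"
  have L: "?L \<in> carrier_mat (1 + nb) (1 + nb)" and R: "?R \<in> carrier_mat (na + nc) (na + nc)"
    using k0 k1 by auto
  have Dk: "D2 * k1 \<in> carrier_mat nb na" using carriers(3) k1(1) by (rule mult_carrier_mat)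
  have "glued h1' * ?R = four_block_mat (D0 * 1\<^sub>m na + 0\<^sub>m 1 nc * k1) (D0 * 0\<^sub>m na nc + 0\<^sub>m 1 nc * 1\<^sub>m nc)
      (h1' * 1\<^sub>m na + D2 * k1) (h1' * 0\<^sub>m na nc + D2 * 1\<^sub>m nc)"
    unfolding glued_def by (rule mult_four_block_mat) (use c' k1 in auto)
  also have "\<dots> = four_block_mat D0 (0\<^sub>m 1 nc) (h1' + D2 * k1) D2"
    using c' k1(1) carriers by simp
  finally have "?L * (glued h1' * ?R) =
     four_block_mat (1\<^sub>m 1 * D0 + 0\<^sub>m 1 nb * (h1' + D2 * k1)) (1\<^sub>m 1 * 0\<^sub>m 1 nc + 0\<^sub>m 1 nb * D2)
      (- k0 * D0 + 1\<^sub>m nb * (h1' + D2 * k1)) (- k0 * 0\<^sub>m 1 nc + 1\<^sub>m nb * D2)"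
    by (simp only:) (rule mult_four_block_mat, use c' k0 Dk in auto)
  also have "\<dots> = four_block_mat D0 (0\<^sub>m 1 nc) (- k0 * D0 + (h1' + D2 * k1)) D2"
    using c' k0(1) k1(1)[THEN carrier_matD(2)] Dk carriers by simp
  also have "- k0 * D0 + (h1' + D2 * k1) = h1"
    unfolding k1(2) uminus_mult_left_mat[OF carriers(1)[THEN carrier_matD(1), folded k0(1)[THEN carrier_matD(2)], symmetric]]
    using c c' kD by (intro eq_matI) (auto simp del: index_mult_mat(1))
  finally have "det (glued h1) = det (?L * (glued h1' * ?R))" by (simp add: glued_def)
  also have "\<dots> = det ?L * (det (glued h1') * det ?R)"
    using L R glued_carrier[OF c'(2)] rank by (simp add: det_mult[of _ "1 + nb"])
  also have "det ?L = 1"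
    using k0(1) by (subst det_four_block_mat_upper_right_zero[of _ 1 _ nb]) auto
  also have "det ?R = 1"
    using k1(1) by (subst det_four_block_mat_upper_right_zero[of _ na _ nc]) auto
  finally show ?thesis by simp
qed

text \<open>Scaling all rows below the first by \<open>u\<close> also scales the columns of \<open>D2\<close>, which the factor
  \<open>u ^ nc\<close> compensates.\<close>

lemma glued_det_scale:
  assumes h1: "h1 \<in> carrier_mat nb na" and rank: "na + nc = 1 + nb"
  shows "det (glued (u \<cdot>\<^sub>m h1)) * u ^ nc = u ^ nb * det (glued h1)"
proof -
  let ?L = "four_block_mat (1\<^sub>m 1) (0\<^sub>m 1 nb) (0\<^sub>m nb 1) (u \<cdot>\<^sub>m 1\<^sub>m nb)"
  let ?R = "four_block_mat (1\<^sub>m na) (0\<^sub>m na nc) (0\<^sub>m nc na) (u \<cdot>\<^sub>m 1\<^sub>m nc)"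
  have L: "?L \<in> carrier_mat (1 + nb) (1 + nb)" and R: "?R \<in> carrier_mat (na + nc) (na + nc)"
    by (intro four_block_carrier_mat; auto)+
  have "glued (u \<cdot>\<^sub>m h1) * ?R =
      four_block_mat (D0 * 1\<^sub>m na + 0\<^sub>m 1 nc * 0\<^sub>m nc na) (D0 * 0\<^sub>m na nc + 0\<^sub>m 1 nc * (u \<cdot>\<^sub>m 1\<^sub>m nc))
      ((u \<cdot>\<^sub>m h1) * 1\<^sub>m na + D2 * 0\<^sub>m nc na) ((u \<cdot>\<^sub>m h1) * 0\<^sub>m na nc + D2 * (u \<cdot>\<^sub>m 1\<^sub>m nc))"
    unfolding glued_def by (rule mult_four_block_mat) (use h1 in auto)
  also have "\<dots> = four_block_mat D0 (0\<^sub>m 1 nc) (u \<cdot>\<^sub>m h1) (u \<cdot>\<^sub>m D2)"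
    using h1 carriers mult_scalar_mat[OF carriers(3)] by simp
  also have "\<dots> = four_block_mat (1\<^sub>m 1 * D0 + 0\<^sub>m 1 nb * h1) (1\<^sub>m 1 * 0\<^sub>m 1 nc + 0\<^sub>m 1 nb * D2)
      (0\<^sub>m nb 1 * D0 + (u \<cdot>\<^sub>m 1\<^sub>m nb) * h1) (0\<^sub>m nb 1 * 0\<^sub>m 1 nc + (u \<cdot>\<^sub>m 1\<^sub>m nb) * D2)"
    using h1 carriers mult_scalar_mat[OF carriers(3)] mult_scalar_mat[OF h1] by simp
  also have "\<dots> = ?L * glued h1"
    unfolding glued_def by (rule mult_four_block_mat[symmetric]) (use h1 in auto)
  finally have "det (glued (u \<cdot>\<^sub>m h1)) * det ?R = det ?L * det (glued h1)"
    using L R glued_carrier[OF h1] glued_carrier[of "u \<cdot>\<^sub>m h1"] h1 rank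
      det_mult[of "glued (u \<cdot>\<^sub>m h1)" "1 + nb" ?R] det_mult[OF L, of "glued h1"] by simp
  also have "det ?L = u ^ nb"
    by (subst det_four_block_mat_upper_right_zero[of _ 1 _ nb]) auto
  also have "det ?R = u ^ nc"
    by (subst det_four_block_mat_upper_right_zero[of _ na _ nc]) auto
  finally show ?thesis .
qed

end

context short_resolution
begin

lemma glued_graded:
  assumes "graded_map (map ((+) s) a) b h1"
  shows "graded_map (a @ map (\<lambda>z. z - s) c) (0 # map (\<lambda>z. z - s) b) (glued h1)"
  unfolding graded_map_def
proof (intro conjI allI impI)
  note h = graded_mapD[OF assms]
  have hc: "h1 \<in> carrier_mat nb na" using h(1) by simp
  show "glued h1 \<in> carrier_mat (length (0 # map (\<lambda>z. z - s) b)) (length (a @ map (\<lambda>z. z - s) c))"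
    using glued_carrier[OF hc] by (simp add: One_nat_def)
  fix i j assume ij: "i < length (0 # map (\<lambda>z. z - s) b)" "j < length (a @ map (\<lambda>z. z - s) c)"
  have e: "glued h1 $$ (i, j) = (if i < 1 then if j < na then D0 $$ (i, j) else 0\<^sub>m 1 nc $$ (i, j - na)
     else if j < na then h1 $$ (i - 1, j) else D2 $$ (i - 1, j - na))"
    unfolding glued_def using ij by (subst index_mat_four_block) auto
  show "homogeneous_of_degree ((a @ map (\<lambda>z. z - s) c) ! j - (0 # map (\<lambda>z. z - s) b) ! i) (glued h1 $$ (i, j))"
  proof (cases i)
    case 0
    then show ?thesis
      unfolding e using ij graded_mapD(2)[OF D0, of 0 j] by (auto simp: nth_append)
  next
    case (Suc k)
    have "a ! j + s - b ! k = a ! j - (b ! k - s)" for k by simp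
    then show ?thesis
      unfolding e using Suc ij h(2)[of k j] graded_mapD(2)[OF D2, of k "j - na"]
      by (auto simp: nth_append algebra_simps)
  qed
qed

lemma homotopy_scale:
  assumes "homotopy g h0 h1 h2"
  shows "homotopy (u * g) (u \<cdot>\<^sub>m h0) (u \<cdot>\<^sub>m h1) (u \<cdot>\<^sub>m h2)"
proof -
  have c: "h0 \<in> carrier_mat na 1" "h1 \<in> carrier_mat nb na" "h2 \<in> carrier_mat nc nb"
    and e: "D0 * h0 = g \<cdot>\<^sub>m 1\<^sub>m 1" "h0 * D0 + D1 * h1 = g \<cdot>\<^sub>m 1\<^sub>m na"
      "h1 * D1 + D2 * h2 = g \<cdot>\<^sub>m 1\<^sub>m nb" "h2 * D2 = g \<cdot>\<^sub>m 1\<^sub>m nc"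
    using assms by (auto simp: homotopy_def)
  have uu: "u \<cdot>\<^sub>m (g \<cdot>\<^sub>m 1\<^sub>m n) = (u * g) \<cdot>\<^sub>m 1\<^sub>m n" for n :: nat by (intro eq_matI) auto
  have "D0 * (u \<cdot>\<^sub>m h0) = u \<cdot>\<^sub>m (D0 * h0)" by (rule mult_smult_distrib[OF carriers(1) c(1)])
  moreover have "(u \<cdot>\<^sub>m h2) * D2 = u \<cdot>\<^sub>m (h2 * D2)" by (rule mult_smult_assoc_mat[OF c(3) carriers(3)])
  moreover have "(u \<cdot>\<^sub>m h0) * D0 + D1 * (u \<cdot>\<^sub>m h1) = u \<cdot>\<^sub>m (h0 * D0 + D1 * h1)"
    unfolding mult_smult_distrib[OF carriers(2) c(2)] mult_smult_assoc_mat[OF c(1) carriers(1)]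
    by (rule add_smult_distrib_left_mat[symmetric, of _ na na]) (use c carriers in auto)
  moreover have "(u \<cdot>\<^sub>m h1) * D1 + D2 * (u \<cdot>\<^sub>m h2) = u \<cdot>\<^sub>m (h1 * D1 + D2 * h2)"
    unfolding mult_smult_distrib[OF carriers(3) c(3)] mult_smult_assoc_mat[OF c(2) carriers(2)]
    by (rule add_smult_distrib_left_mat[symmetric, of _ nb nb]) (use c carriers in auto)
  ultimately show ?thesis using c unfolding homotopy_def e uu by simp
qed

text \<open>The determinants \<open>P\<close> and \<open>Q\<close> belong to the multipliers \<open>x^N\<close> and \<open>y^N\<close>. Scaling both homotopies to the
  multiplier \<open>(x y)^N\<close> and comparing them gives \<open>P = x^(N m) u\<close> and \<open>Q = y^(N m) u\<close> with a common
  cofactor \<open>u\<close>, where \<open>m = na - 1\<close>. As \<open>u\<close> divides a power of \<open>x\<close> and the same power of \<open>y\<close>, it is a unit.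
  Its degree, which is zero, is the alternating sum of the shifts.\<close>

lemma shift_sum:
  assumes x: "var i ^ N \<in> ideal" and y: "var j ^ N \<in> ideal" and ij: "i \<noteq> j"
    and rank: "na + nc = 1 + nb" and na: "na \<ge> 1"
  shows "sum_list a + sum_list c = sum_list b"
proof -
  define x where "x = (var i :: 'k poly3) ^ N"
  define y where "y = (var j :: 'k poly3) ^ N"
  have xy0: "x \<noteq> 0" "y \<noteq> 0" by (simp_all add: x_def y_def)
  have pow: "x ^ l = var i ^ (N * l)" "y ^ l = var j ^ (N * l)" for l
    by (simp_all add: x_def y_def power_mult)
  have cancel_x: "u = v" if "x ^ l * u = x ^ l * v" for u v l
    using that xy0 by simp
  have cancel_y: "u = v" if "y ^ l * u = y ^ l * v" for u v l
    using that xy0 by simp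
  obtain h0 h1 h2 where h: "homotopy x h0 h1 h2" "graded_map (map ((+) (int N)) a) b h1"
    using homotopy_exists[OF x homogeneous_of_degree_var_power] unfolding x_def by blast
  obtain k0 k1 k2 where k: "homotopy y k0 k1 k2"
    using homotopy_exists[OF y homogeneous_of_degree_var_power] unfolding y_def by blast
  define P where "P = det (glued h1)"
  define Q where "Q = det (glued k1)"
  have c: "h1 \<in> carrier_mat nb na" "k1 \<in> carrier_mat nb na"
    using h k by (auto simp: homotopy_def)
  \<comment> \<open>\<open>E\<close> is the determinant for the common multiplier.\<close>
  define E where "E = det (glued (y \<cdot>\<^sub>m h1))"
  have "E = det (glued (x \<cdot>\<^sub>m k1))"
    using glued_det_unique[OF homotopy_scale[OF h(1), of y] _ rank] homotopy_scale[OF k, of x]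
    unfolding E_def by (simp add: mult.commute)
  then have E: "y ^ nb * P = E * y ^ nc" "x ^ nb * Q = E * x ^ nc"
    using glued_det_scale[OF c(1) rank, of y] glued_det_scale[OF c(2) rank, of x]
    by (simp_all add: P_def Q_def E_def)
  have "y ^ nb * P * x ^ nc = x ^ nb * Q * y ^ nc"
    unfolding E by (simp only: mult_ac)
  moreover define m where "m = na - 1"
  have nb: "nb = m + nc" using rank na by (simp add: m_def)
  ultimately have "(x ^ nc * y ^ nc) * (y ^ m * P) = (x ^ nc * y ^ nc) * (x ^ m * Q)"
    unfolding nb by (simp only: power_add mult_ac)
  then have "y ^ m * P = x ^ m * Q"
    using xy0 by simp
  then obtain u where u: "P = x ^ m * u" "Q = y ^ m * u"
    using var_powers_coprime[of j "N * m" P i "N * m" Q] ij unfolding pow by metis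
  obtain p where "P * p = x ^ (1 + nb)" using glued_det_dvd[OF h(1) rank] P_def by blast
  then have "x ^ m * (u * p) = x ^ m * x ^ (1 + nc)" unfolding u nb by (simp only: power_add mult_ac)
  then have p: "u * p = x ^ (1 + nc)" by (rule cancel_x)
  obtain q where "Q * q = y ^ (1 + nb)" using glued_det_dvd[OF k rank] Q_def by blast
  then have "y ^ m * (u * q) = y ^ m * y ^ (1 + nc)" unfolding u nb by (simp only: power_add mult_ac)
  then have q: "u * q = y ^ (1 + nc)" by (rule cancel_y)
  have u0: "u \<noteq> 0" using p xy0 by auto
  have "u * (y ^ (1 + nc) * p) = u * (x ^ (1 + nc) * q)"
    unfolding p[symmetric] q[symmetric] by (simp only: mult_ac)
  then have "y ^ (1 + nc) * p = x ^ (1 + nc) * q" using u0 by simp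
  then obtain r where r: "p = x ^ (1 + nc) * r"
    using var_powers_coprime[of j "N * (1 + nc)" p i "N * (1 + nc)" q] ij unfolding pow by metis
  then have "x ^ (1 + nc) * (u * r) = x ^ (1 + nc) * 1" using p unfolding r by (simp only: mult.left_commute mult_1_right)
  then have unit: "u * r = 1" by (rule cancel_x)
  have "homogeneous_of_degree (sum_list (a @ map (\<lambda>z. z - int N) c) - sum_list (0 # map (\<lambda>z. z - int N) b)) P"
    unfolding P_def using rank by (intro graded_map_det glued_graded h(2)) simp
  moreover have "sum_list (map (\<lambda>z. z - int N) zs) = sum_list zs - int (length zs) * int N" for zs
    by (induction zs) (auto simp: algebra_simps)
  ultimately have "homogeneous_of_degree (sum_list a + sum_list c - sum_list b + int m * int N) (x ^ m * u)"
    unfolding u nb by (simp add: algebra_simps nb)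
  moreover have "homogeneous_of_degree (int m * int N) (x ^ m)"
    using homogeneous_of_degree_var_power[of "N * m" i] by (simp add: x_def mult.commute flip: power_mult)
  ultimately have "homogeneous_of_degree (sum_list a + sum_list c - sum_list b) u"
    using homogeneous_factor[of "int m * int N" "x ^ m" _ u] xy0 by fastforce
  then have "sum_list a + sum_list c - sum_list b = 0" using unit by (rule homogeneous_unit_degree)
  then show ?thesis by simp
qed

end

section \<open>Acyclicity of complexes with homology of finite length\<close>

lemma var_powers_coprime_vec:
  fixes v w :: "'k::field poly3 vec"
  assumes "v \<in> carrier_vec n" "w \<in> carrier_vec n" "var j ^ k \<cdot>\<^sub>v v = var i ^ l \<cdot>\<^sub>v w" "i \<noteq> j"
  obtains u where "u \<in> carrier_vec n" "v = var i ^ l \<cdot>\<^sub>v u" "w = var j ^ k \<cdot>\<^sub>v u"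
proof -
  have "\<exists>h. v $ r = var i ^ l * h \<and> w $ r = var j ^ k * h" if "r < n" for r
  proof -
    have "var j ^ k * v $ r = var i ^ l * w $ r"
      using arg_cong[OF assms(3), of "\<lambda>v. v $ r"] that assms(1,2) by simp
    then show ?thesis using var_powers_coprime[of j k "v $ r" i l "w $ r"] assms(4) by metis
  qed
  then obtain h where "\<And>r. r < n \<Longrightarrow> v $ r = var i ^ l * h r \<and> w $ r = var j ^ k * h r" by metis
  then show thesis
    using assms by (intro that[of "vec n h"]) (auto intro!: eq_vecI)
qed

lemma third_var_power_regular_vec:
  fixes p q w :: "'k::field poly3 vec"
  assumes "p \<in> carrier_vec n" "q \<in> carrier_vec n" "w \<in> carrier_vec n"
    and e: "var c ^ l \<cdot>\<^sub>v w = var a ^ k \<cdot>\<^sub>v p + var b ^ m \<cdot>\<^sub>v q" and d: "a \<noteq> b" "a \<noteq> c" "b \<noteq> c"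
  obtains p' q' where "p' \<in> carrier_vec n" "q' \<in> carrier_vec n" "w = var a ^ k \<cdot>\<^sub>v p' + var b ^ m \<cdot>\<^sub>v q'"
proof -
  have "\<exists>p' q'. w $ r = var a ^ k * p' + var b ^ m * q'" if "r < n" for r
  proof -
    have "var c ^ l * w $ r = var a ^ k * p $ r + var b ^ m * q $ r"
      using arg_cong[OF e, of "\<lambda>v. v $ r"] that assms(1-3) by simp
    then show ?thesis using third_var_power_regular[of c l "w $ r" a k "p $ r" b m "q $ r"] d by metis
  qed
  then obtain f g where "\<And>r. r < n \<Longrightarrow> w $ r = var a ^ k * f r + var b ^ m * g r" by metis
  then show thesis
    using assms(3) by (intro that[of "vec n f" "vec n g"]) (auto intro!: eq_vecI)
qed

lemma mult_mat_smult_vec: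
  fixes M :: "'a::comm_ring_1 mat"
  assumes "M \<in> carrier_mat n m" "v \<in> carrier_vec m"
  shows "M *\<^sub>v (s \<cdot>\<^sub>v v) = s \<cdot>\<^sub>v (M *\<^sub>v v)"
  using assms by (intro eq_vecI) (auto simp: scalar_prod_smult_right)

lemma smult_vec_cancel:
  fixes v w :: "'a::idom vec"
  assumes "v \<in> carrier_vec n" "w \<in> carrier_vec n" "s \<cdot>\<^sub>v v = s \<cdot>\<^sub>v w" "s \<noteq> 0"
  shows "v = w"
proof (rule eq_vecI)
  fix r assume "r < dim_vec w"
  then show "v $ r = w $ r"
    using arg_cong[OF assms(3), of "\<lambda>v. v $ r"] assms(1,2,4) by simp
qed (use assms in auto)

lemma minus_vec_eq_0:
  fixes v w :: "'a::comm_ring_1 vec"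
  assumes "v \<in> carrier_vec n" "w \<in> carrier_vec n" "v - w = 0\<^sub>v n"
  shows "v = w"
proof (rule eq_vecI)
  fix r assume "r < dim_vec w"
  then show "v $ r = w $ r"
    using arg_cong[OF assms(3), of "\<lambda>v. v $ r"] assms(1,2) by simp
qed (use assms in auto)

lemma smult_mat_kernel_minus:
  fixes M :: "'a::comm_ring_1 mat"
  assumes M: "M \<in> carrier_mat m n" and u: "u \<in> carrier_vec n" and u': "u' \<in> carrier_vec n"
    and "s \<cdot>\<^sub>v (M *\<^sub>v u) = t \<cdot>\<^sub>v (M *\<^sub>v u')"
  shows "s \<cdot>\<^sub>v u - t \<cdot>\<^sub>v u' \<in> mat_kernel M"
proof (rule mat_kernelI[OF M])
  have "M *\<^sub>v (s \<cdot>\<^sub>v u - t \<cdot>\<^sub>v u') = s \<cdot>\<^sub>v (M *\<^sub>v u) - t \<cdot>\<^sub>v (M *\<^sub>v u')"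
    using M u u' by (simp add: mult_minus_distrib_mat_vec mult_mat_smult_vec)
  then show "M *\<^sub>v (s \<cdot>\<^sub>v u - t \<cdot>\<^sub>v u') = 0\<^sub>v m"
    using assms(4) M u' by auto
qed (use u u' in auto)

text \<open>A special case of the acyclicity lemma of Peskine and Szpiro: in a complex of free modules of length
  three whose homology at the sources of \<open>M1\<close> and \<open>M2\<close> is annihilated by the regular sequence
  \<open>x^N, y^N, z^N\<close>, this homology vanishes. Homology classes are multiplied by the members of the sequence, lifted, and
  the lifts are compared. This needs a regular sequence of length two at \<open>M2\<close> and of length three at \<open>M1\<close>.\<close>

theorem acyclicity:
  fixes M1 M2 M3 :: "'k::field poly3 mat"
  assumes M1: "M1 \<in> carrier_mat n0 n1" and M2: "M2 \<in> carrier_mat n1 n2" and M3: "M3 \<in> carrier_mat n2 n3"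
    and z: "M2 * M3 = 0\<^sub>m n1 n3" and inj: "mat_kernel M3 = {0\<^sub>v n3}"
    and H1: "\<And>i v. v \<in> mat_kernel M1 \<Longrightarrow> var i ^ N \<cdot>\<^sub>v v \<in> mat_image M2"
    and H2: "\<And>i v. v \<in> mat_kernel M2 \<Longrightarrow> var i ^ N \<cdot>\<^sub>v v \<in> mat_image M3"
  shows "mat_kernel M1 \<subseteq> mat_image M2"
proof
  have d: "(0::3) \<noteq> 1" "(0::3) \<noteq> 2" "(1::3) \<noteq> 2" by simp_all
  define s where "s i = (var i :: 'k poly3) ^ N" for i
  have s0: "s i \<noteq> 0" for i by (simp add: s_def)
  have inj': "v = w" if "v \<in> carrier_vec n3" "w \<in> carrier_vec n3" "M3 *\<^sub>v v = M3 *\<^sub>v w" for v w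
  proof -
    have "M3 *\<^sub>v (v - w) = 0\<^sub>v n2"
      using that M3 by (auto simp: mult_minus_distrib_mat_vec)
    then have "v - w \<in> mat_kernel M3" using that M3 by (intro mat_kernelI[OF M3]) auto
    then have "v - w = 0\<^sub>v n3" using inj by auto
    then show ?thesis by (rule minus_vec_eq_0[OF that(1,2)])
  qed
  \<comment> \<open>The lifts \<open>p\<close>, \<open>q\<close> of two multiples of \<open>u\<close> satisfy \<open>s 1 p = s 0 q\<close>, so that \<open>p\<close> is divisible by \<open>s 0\<close>.\<close>
  have exact2: "\<exists>q. q \<in> carrier_vec n3 \<and> u = M3 *\<^sub>v q" if u: "u \<in> mat_kernel M2" for u
  proof -
    have uc: "u \<in> carrier_vec n2" using mat_kernelD[OF M2 u] by simp
    obtain p q where p: "p \<in> carrier_vec n3" "s 0 \<cdot>\<^sub>v u = M3 *\<^sub>v p"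
      and q: "q \<in> carrier_vec n3" "s 1 \<cdot>\<^sub>v u = M3 *\<^sub>v q"
      using H2[OF u, of 0] H2[OF u, of 1] M3 unfolding s_def mat_image_def by auto
    have "M3 *\<^sub>v (s 1 \<cdot>\<^sub>v p) = M3 *\<^sub>v (s 0 \<cdot>\<^sub>v q)"
      using mult_mat_smult_vec[OF M3 p(1)] mult_mat_smult_vec[OF M3 q(1)] p(2) q(2) by (metis smult_smult_assoc mult.commute)
    then have "s 1 \<cdot>\<^sub>v p = s 0 \<cdot>\<^sub>v q" by (rule inj'[rotated 2]) (use p q in auto)
    then obtain r where r: "r \<in> carrier_vec n3" "p = s 0 \<cdot>\<^sub>v r"
      using var_powers_coprime_vec[OF p(1) q(1), of 1 N 0 N] d unfolding s_def by blast
    have "s 0 \<cdot>\<^sub>v u = s 0 \<cdot>\<^sub>v (M3 *\<^sub>v r)" unfolding p(2) r(2) by (rule mult_mat_smult_vec[OF M3 r(1)])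
    then have "u = M3 *\<^sub>v r" using smult_vec_cancel[OF uc _ _ s0] M3 r(1) by auto
    with r(1) show ?thesis by blast
  qed
  fix v assume v: "v \<in> mat_kernel M1"
  have vc: "v \<in> carrier_vec n1" using mat_kernelD[OF M1 v] by simp
  obtain u where u: "\<And>i. u i \<in> carrier_vec n2" "\<And>i. M2 *\<^sub>v u i = s i \<cdot>\<^sub>v v"
    using H1[OF v] M2 unfolding s_def mat_image_def by (auto simp: image_iff) metis
  \<comment> \<open>The lifts \<open>u i\<close> of the multiples of \<open>v\<close> agree up to the image of \<open>M3\<close>, and the discrepancies \<open>w i j\<close>
    satisfy a cocycle relation.\<close>
  have ker: "s j \<cdot>\<^sub>v u i - s i \<cdot>\<^sub>v u j \<in> mat_kernel M2" for i j
    by (rule smult_mat_kernel_minus[OF M2 u(1) u(1)]) (simp add: u(2) smult_smult_assoc mult.commute)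
  define w where "w i j = (SOME q. q \<in> carrier_vec n3 \<and> s j \<cdot>\<^sub>v u i - s i \<cdot>\<^sub>v u j = M3 *\<^sub>v q)" for i j
  have w: "w i j \<in> carrier_vec n3" "s j \<cdot>\<^sub>v u i - s i \<cdot>\<^sub>v u j = M3 *\<^sub>v w i j" for i j
    using someI_ex[OF exact2[OF ker[of j i]]] unfolding w_def by auto
  have "M3 *\<^sub>v (s 2 \<cdot>\<^sub>v w 0 1) = M3 *\<^sub>v (s 0 \<cdot>\<^sub>v w 2 1 + s 1 \<cdot>\<^sub>v w 0 2)"
  proof -
    have "M3 *\<^sub>v (s 0 \<cdot>\<^sub>v w 2 1 + s 1 \<cdot>\<^sub>v w 0 2) =
      s 0 \<cdot>\<^sub>v (s 1 \<cdot>\<^sub>v u 2 - s 2 \<cdot>\<^sub>v u 1) + s 1 \<cdot>\<^sub>v (s 2 \<cdot>\<^sub>v u 0 - s 0 \<cdot>\<^sub>v u 2)"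
      using M3 w(1) unfolding w(2) by (simp add: mult_add_distrib_mat_vec mult_mat_smult_vec)
    also have "\<dots> = s 2 \<cdot>\<^sub>v (s 1 \<cdot>\<^sub>v u 0 - s 0 \<cdot>\<^sub>v u 1)"
      using carrier_vecD[OF u(1)] by (intro eq_vecI) (auto simp: algebra_simps)
    also have "\<dots> = M3 *\<^sub>v (s 2 \<cdot>\<^sub>v w 0 1)"
      using M3 w(1) unfolding w(2) by (simp add: mult_mat_smult_vec)
    finally show ?thesis ..
  qed
  then have "s 2 \<cdot>\<^sub>v w 0 1 = s 0 \<cdot>\<^sub>v w 2 1 + s 1 \<cdot>\<^sub>v w 0 2"
    by (rule inj'[rotated 2]) (use w(1) in auto)
  then obtain p q where pq: "p \<in> carrier_vec n3" "q \<in> carrier_vec n3" "w 0 1 = s 0 \<cdot>\<^sub>v p + s 1 \<cdot>\<^sub>v q"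
    using third_var_power_regular_vec[OF w(1) w(1) w(1), of 2 N _ _ 0 N _ _ 1 N] d unfolding s_def by blast
  \<comment> \<open>Correcting \<open>u 0\<close> by \<open>M3 q\<close> makes it divisible by \<open>s 0\<close>, and the quotient \<open>t\<close> is a preimage of \<open>v\<close>.\<close>
  have Mp: "M3 *\<^sub>v p \<in> carrier_vec n2" "M3 *\<^sub>v q \<in> carrier_vec n2" using M3 pq by auto
  have "s 1 \<cdot>\<^sub>v u 0 - s 0 \<cdot>\<^sub>v u 1 = s 0 \<cdot>\<^sub>v (M3 *\<^sub>v p) + s 1 \<cdot>\<^sub>v (M3 *\<^sub>v q)"
    using M3 pq(1,2) unfolding w(2) pq(3) by (simp add: mult_add_distrib_mat_vec mult_mat_smult_vec)
  then have "s 1 \<cdot>\<^sub>v (u 0 - M3 *\<^sub>v q) = s 0 \<cdot>\<^sub>v (u 1 + M3 *\<^sub>v p)" (is "?l = ?r")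
  proof (intro eq_vecI)
    assume e: "s 1 \<cdot>\<^sub>v u 0 - s 0 \<cdot>\<^sub>v u 1 = s 0 \<cdot>\<^sub>v (M3 *\<^sub>v p) + s 1 \<cdot>\<^sub>v (M3 *\<^sub>v q)"
    fix r assume "r < dim_vec ?r"
    then have r: "r < n2" using M3 by simp
    have "s 1 * u 0 $ r - s 0 * u 1 $ r = s 0 * (M3 *\<^sub>v p) $ r + s 1 * (M3 *\<^sub>v q) $ r"
      using arg_cong[OF e, of "\<lambda>v. v $ r"] r carrier_vecD[OF u(1)] carrier_vecD[OF Mp(1)] carrier_vecD[OF Mp(2)]
      by (simp del: index_mult_mat_vec)
    then show "?l $ r = ?r $ r"
      using r carrier_vecD[OF u(1)] carrier_vecD[OF Mp(1)] carrier_vecD[OF Mp(2)]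
      by (simp del: index_mult_mat_vec add: algebra_simps)
  qed (use carrier_vecD[OF u(1)] carrier_vecD[OF Mp(1)] carrier_vecD[OF Mp(2)] in simp)
  then obtain t where t: "t \<in> carrier_vec n2" "u 0 - M3 *\<^sub>v q = s 0 \<cdot>\<^sub>v t"
    using var_powers_coprime_vec[of "u 0 - M3 *\<^sub>v q" n2 "u 1 + M3 *\<^sub>v p" 1 N 0 N] d u(1) Mp unfolding s_def
    by (metis add_carrier_vec minus_carrier_vec)
  have "M2 *\<^sub>v (M3 *\<^sub>v q) = 0\<^sub>v n1"
  proof -
    have "0\<^sub>m n1 n3 *\<^sub>v q = 0\<^sub>v n1" using pq(2) by (intro eq_vecI) auto
    then show ?thesis using assoc_mult_mat_vec[OF M2 M3 pq(2)] z by simp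
  qed
  then have "M2 *\<^sub>v (u 0 - M3 *\<^sub>v q) = s 0 \<cdot>\<^sub>v v"
    using mult_minus_distrib_mat_vec[OF M2 u(1) Mp(2)] u(2)[of 0] vc by auto
  then have "s 0 \<cdot>\<^sub>v v = s 0 \<cdot>\<^sub>v (M2 *\<^sub>v t)"
    unfolding t(2) mult_mat_smult_vec[OF M2 t(1)] ..
  then have "v = M2 *\<^sub>v t" using smult_vec_cancel[OF vc _ _ s0] M2 t(1) by auto
  then show "v \<in> mat_image M2" using M2 t(1) by (auto simp: mat_image_def)
qed

text \<open>By the height theorem two elements of \<open>(x, y, z)\<close> cannot generate an ideal of finite colength. Here
  this follows from acyclicity: the Koszul complex of \<open>p\<close> and \<open>q\<close> is one step shorter than the bound, so
  even its last homology \<open>R/(p, q)\<close> would have to vanish.\<close>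

lemma two_generators_not_all_var_powers:
  fixes p q :: "'k::field poly3"
  assumes pq: "Poly_Mapping.lookup p 0 = 0" "Poly_Mapping.lookup q 0 = 0"
    and fg: "\<And>i. var i ^ N = f i * p + g i * q"
  shows False
proof -
  define M2 where "M2 = mat 1 2 (\<lambda>(i, j). if j = 0 then p else q)"
  define M3 where "M3 = mat 2 1 (\<lambda>(i, j). if i = 0 then q else - p)"
  have M2v: "M2 *\<^sub>v v = vec 1 (\<lambda>_. p * v $ 0 + q * v $ 1)" if "v \<in> carrier_vec 2" for v
    using that by (intro eq_vecI) (auto simp: M2_def scalar_prod_def numeral_2_eq_2 One_nat_def)
  have M3v: "M3 *\<^sub>v v = vec 2 (\<lambda>i. if i = 0 then q * v $ 0 else - p * v $ 0)" if "v \<in> carrier_vec 1" for v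
    using that by (intro eq_vecI) (auto simp: M3_def scalar_prod_def One_nat_def)
  have eq2: "u = v \<longleftrightarrow> u $ 0 = v $ 0 \<and> u $ 1 = v $ 1" if "u \<in> carrier_vec 2" "v \<in> carrier_vec 2" for u v :: "'k poly3 vec"
    using that by (auto simp: less_2_cases_iff One_nat_def intro!: eq_vecI)
  have pq0: "p \<noteq> 0 \<or> q \<noteq> 0"
    using fg[of 0] var_power_neq_0[of 0 N, where 'k = 'k] by auto
  have "mat_kernel (0\<^sub>m 0 1) \<subseteq> mat_image M2"
  proof (rule acyclicity)
    show "0\<^sub>m 0 1 \<in> carrier_mat 0 1" "M2 \<in> carrier_mat 1 2" "M3 \<in> carrier_mat 2 1"
      by (simp_all add: M2_def M3_def)
    show "M2 * M3 = 0\<^sub>m 1 1"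
      by (intro eq_matI) (auto simp: M2_def M3_def scalar_prod_def numeral_2_eq_2 One_nat_def)
    show "mat_kernel M3 = {0\<^sub>v 1}"
    proof (intro equalityI subsetI)
      fix v assume "v \<in> mat_kernel M3"
      then have v: "v \<in> carrier_vec 1" "M3 *\<^sub>v v = 0\<^sub>v 2"
        using mat_kernelD[of M3 2 1 v] by (auto simp: M3_def)
      have "q * v $ 0 = 0" "p * v $ 0 = 0"
        using arg_cong[OF v(2), of "\<lambda>u. u $ 0"] arg_cong[OF v(2), of "\<lambda>u. u $ 1"] M3v[OF v(1)]
        by (simp_all add: One_nat_def)
      then have "v $ 0 = 0" using pq0 by auto
      then show "v \<in> {0\<^sub>v 1}" using v(1) by (auto intro!: eq_vecI)
    next
      fix v assume "v \<in> {0\<^sub>v 1 :: 'k poly3 vec}"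
      then show "v \<in> mat_kernel M3"
        using M3v[of "0\<^sub>v 1"] by (intro mat_kernelI[of _ 2 1]) (auto simp: M3_def One_nat_def intro!: eq_vecI)
    qed
    show "var i ^ N \<cdot>\<^sub>v v \<in> mat_image M2" if "v \<in> mat_kernel (0\<^sub>m 0 1)" for i v
    proof -
      have v: "v \<in> carrier_vec 1" using that by (auto simp: mat_kernel_def)
      define w where "w = vec 2 (\<lambda>k. if k = 0 then f i * v $ 0 else g i * v $ 0)"
      have "var i ^ N \<cdot>\<^sub>v v = M2 *\<^sub>v w"
        using v fg[of i] M2v[of w] by (intro eq_vecI) (auto simp: w_def algebra_simps)
      then show ?thesis by (auto simp: mat_image_def M2_def w_def)
    qed
    show "var i ^ N \<cdot>\<^sub>v v \<in> mat_image M3" if "v \<in> mat_kernel M2" for i v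
    proof -
      have v: "v \<in> carrier_vec 2" "M2 *\<^sub>v v = 0\<^sub>v 1"
        using that mat_kernelD[of M2 1 2 v] by (auto simp: M2_def)
      have z: "p * v $ 0 = - (q * v $ 1)"
        using arg_cong[OF v(2), of "\<lambda>u. u $ 0"] M2v[OF v(1)] by (simp add: eq_neg_iff_add_eq_0)
      define w where "w = vec 1 (\<lambda>k. g i * v $ 0 - f i * v $ 1)"
      have "(f i * p + g i * q) * v $ 0 = q * (g i * v $ 0 - f i * v $ 1)"
        using arg_cong[OF z, of "\<lambda>u. f i * u"] by (simp add: algebra_simps)
      moreover have "(f i * p + g i * q) * v $ 1 = - p * (g i * v $ 0 - f i * v $ 1)"
        using arg_cong[OF z, of "\<lambda>u. g i * u"] by (simp add: algebra_simps)
      ultimately have "var i ^ N \<cdot>\<^sub>v v = M3 *\<^sub>v w"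
        using v(1) M3v[of w] by (subst eq2) (auto simp: w_def fg)
      then show ?thesis by (auto simp: mat_image_def M3_def w_def)
    qed
  qed
  moreover have "vec 1 (\<lambda>_. 1) \<in> mat_kernel (0\<^sub>m 0 1 :: 'k poly3 mat)"
    by (auto simp: mat_kernel_def)
  ultimately obtain w where w: "w \<in> carrier_vec 2" "vec 1 (\<lambda>_. 1) = M2 *\<^sub>v w"
    by (auto simp: mat_image_def M2_def)
  have "vec 1 (\<lambda>_. 1) $ 0 = vec 1 (\<lambda>_. p * w $ 0 + q * w $ 1) $ 0"
    unfolding w(2) M2v[OF w(1)] ..
  then have "Poly_Mapping.lookup 1 0 = Poly_Mapping.lookup (p * w $ 0 + q * w $ 1) 0" by simp
  also have "\<dots> = 0" using pq by (simp add: lookup_add const_term_mult)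
  finally have "Poly_Mapping.lookup (1 :: 'k poly3) 0 = 0" .
  then show False by simp
qed

section \<open>Minimal resolutions of quotients of finite length\<close>

text \<open>The common exponent \<open>N\<close> witnesses that the quotient by the ideal has finite length.\<close>

locale minimal_finite_length_resolution = short_resolution a b c D0 D1 D2
  for a b c and D0 D1 D2 :: "'k::field poly3 mat" +
  fixes N :: nat
  assumes minimal1: "\<And>r j. r < length a \<Longrightarrow> j < length b \<Longrightarrow> Poly_Mapping.lookup (D1 $$ (r, j)) 0 = 0"
    and minimal2: "\<And>r j. r < length b \<Longrightarrow> j < length c \<Longrightarrow> Poly_Mapping.lookup (D2 $$ (r, j)) 0 = 0"
    and var_powers: "\<And>i. var i ^ N \<in> ideal"
begin

lemma D2_entry_0:
  assumes "r < nb" "j < nc" "c ! j \<le> b ! r"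
  shows "D2 $$ (r, j) = 0"
  using homogeneous_nonpos_degree[OF graded_mapD(2)[OF D2 assms(1,2)] _ minimal2[OF assms(1,2)]] assms(3)
  by simp

lemma homotopy_var:
  obtains h0 h1 h2 where "homotopy (var i ^ N) h0 h1 h2"
  using homotopy_exists[OF var_powers homogeneous_of_degree_var_power] by blast

text \<open>The transposed homotopies show that powers of the variables annihilate the homology of the dual
  complex.\<close>

lemma dual_exact: "mat_kernel (transpose_mat D2) \<subseteq> mat_image (transpose_mat D1)"
proof (rule acyclicity)
  show "transpose_mat D2 \<in> carrier_mat nc nb" "transpose_mat D1 \<in> carrier_mat nb na"
    "transpose_mat D0 \<in> carrier_mat na 1" by simp_all
  have "transpose_mat D1 * transpose_mat D0 = transpose_mat (D0 * D1)"
    by (rule transpose_mult[symmetric]) (rule carriers)+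
  then show "transpose_mat D1 * transpose_mat D0 = 0\<^sub>m nb 1" by simp
  show "mat_kernel (transpose_mat D0) = {0\<^sub>v 1}"
  proof (intro equalityI subsetI)
    fix v assume "v \<in> mat_kernel (transpose_mat D0)"
    then have v: "v \<in> carrier_vec 1" "transpose_mat D0 *\<^sub>v v = 0\<^sub>v na"
      by (auto simp: mat_kernel_def)
    have e: "D0 $$ (0, j) * v $ 0 = 0" if "j < na" for j
      using arg_cong[OF v(2), of "\<lambda>u. u $ j"] that v(1) by (simp add: scalar_prod_def One_nat_def)
    obtain w where w: "w \<in> carrier_vec na" "var 0 ^ N = (D0 *\<^sub>v w) $ 0"
      using var_powers[of 0] by (auto simp: ideal_def mat_image_def)
    have "var 0 ^ N * v $ 0 = (\<Sum>j = 0..<na. D0 $$ (0, j) * v $ 0 * w $ j)"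
      unfolding w(2) using w(1) by (simp add: scalar_prod_def sum_distrib_left mult_ac)
    also have "\<dots> = 0" by (intro sum.neutral ballI) (use e in simp)
    finally have "v $ 0 = 0" by simp
    then show "v \<in> {0\<^sub>v 1}" using v(1) by (auto intro!: eq_vecI)
  next
    fix v assume "v \<in> {0\<^sub>v 1 :: 'k poly3 vec}"
    then show "v \<in> mat_kernel (transpose_mat D0)"
      by (auto simp: mat_kernel_def intro!: eq_vecI)
  qed
  have scalar: "(g \<cdot>\<^sub>m 1\<^sub>m n) *\<^sub>v v = g \<cdot>\<^sub>v v" if "v \<in> carrier_vec n" for v :: "'k poly3 vec" and g n
    using that by (intro eq_vecI) auto
  \<comment> \<open>The transposed homotopy equation, applied to a vector that \<open>E'\<close> transposed annihilates.\<close>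
  have chase: "g \<cdot>\<^sub>v v \<in> mat_image (transpose_mat E)"
    if v: "v \<in> mat_kernel (transpose_mat E')" and E: "E \<in> carrier_mat l n" "E' \<in> carrier_mat n m"
      and k: "k \<in> carrier_mat n l" "k' \<in> carrier_mat m n" "k * E + E' * k' = g \<cdot>\<^sub>m 1\<^sub>m n"
    for v g and E E' k k' :: "'k poly3 mat" and l n m
  proof -
    have vc: "v \<in> carrier_vec n" "transpose_mat E' *\<^sub>v v = 0\<^sub>v m"
      using v E by (auto simp: mat_kernel_def)
    have kv: "transpose_mat k *\<^sub>v v \<in> carrier_vec l" using k(1) vc(1) by simp
    have "g \<cdot>\<^sub>m 1\<^sub>m n = transpose_mat (k * E + E' * k')" unfolding k(3) by (intro eq_matI) auto
    also have "\<dots> = transpose_mat E * transpose_mat k + transpose_mat k' * transpose_mat E'"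
      using transpose_add[OF mult_carrier_mat[OF k(1) E(1)] mult_carrier_mat[OF E(2) k(2)]]
        transpose_mult[OF k(1) E(1)] transpose_mult[OF E(2) k(2)] by simp
    finally have "g \<cdot>\<^sub>v v = (transpose_mat E * transpose_mat k + transpose_mat k' * transpose_mat E') *\<^sub>v v"
      using scalar[OF vc(1)] by metis
    also have "\<dots> = transpose_mat E *\<^sub>v (transpose_mat k *\<^sub>v v) + transpose_mat k' *\<^sub>v (transpose_mat E' *\<^sub>v v)"
      using k E vc(1) by (simp add: add_mult_distrib_mat_vec[of _ n n] assoc_mult_mat_vec[of _ n l _ n] assoc_mult_mat_vec[of _ n m _ n])
    also have "transpose_mat k' *\<^sub>v (transpose_mat E' *\<^sub>v v) = 0\<^sub>v n"
      unfolding vc(2) using k(2) by (intro eq_vecI) auto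
    also have "transpose_mat E *\<^sub>v (transpose_mat k *\<^sub>v v) + 0\<^sub>v n = transpose_mat E *\<^sub>v (transpose_mat k *\<^sub>v v)"
      using E kv by simp
    finally show ?thesis using kv E by (auto simp: mat_image_def)
  qed
  show "var i ^ N \<cdot>\<^sub>v v \<in> mat_image (transpose_mat D1)" if "v \<in> mat_kernel (transpose_mat D2)" for i v
  proof -
    obtain h0 h1 h2 where "homotopy (var i ^ N) h0 h1 h2" by (rule homotopy_var)
    then show ?thesis unfolding homotopy_def by (intro chase[OF that carriers(2,3), of h1 h2]) auto
  qed
  show "var i ^ N \<cdot>\<^sub>v v \<in> mat_image (transpose_mat D0)" if "v \<in> mat_kernel (transpose_mat D1)" for i v
  proof -
    obtain h0 h1 h2 where "homotopy (var i ^ N) h0 h1 h2" by (rule homotopy_var)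
    then show ?thesis unfolding homotopy_def by (intro chase[OF that carriers(1,2), of h0 h1]) auto
  qed
qed

text \<open>The coordinate function of a zero row is a cocycle of the dual complex. It would be a combination of
  the rows of \<open>D1\<close>, but a coordinate function has a constant entry and \<open>D1\<close> has none.\<close>

lemma no_zero_row:
  assumes r: "r < nb"
  shows "\<exists>j<nc. D2 $$ (r, j) \<noteq> 0"
proof (rule ccontr)
  assume "\<not> ?thesis"
  then have z: "D2 $$ (r, j) = 0" if "j < nc" for j using that by blast
  have "transpose_mat D2 *\<^sub>v unit_vec nb r = 0\<^sub>v nc"
    using r z by (intro eq_vecI) auto
  then have "unit_vec nb r \<in> mat_kernel (transpose_mat D2)" by (simp add: mat_kernel_def)
  then obtain w where w: "w \<in> carrier_vec na" "unit_vec nb r = transpose_mat D1 *\<^sub>v w"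
    using dual_exact by (auto simp: mat_image_def)
  have e: "1 = (\<Sum>i = 0..<na. D1 $$ (i, r) * w $ i)"
    using arg_cong[OF w(2), of "\<lambda>u. u $ r"] r w(1) by (simp add: scalar_prod_def)
  have "Poly_Mapping.lookup (1 :: 'k poly3) 0 = (\<Sum>i = 0..<na. Poly_Mapping.lookup (D1 $$ (i, r) * w $ i) 0)"
    unfolding lookup_sum[symmetric] by (rule arg_cong[OF e])
  also have "\<dots> = 0" using minimal1 r by (simp add: const_term_mult)
  finally show False by simp
qed

text \<open>The last homotopy equation writes \<open>x^N, y^N, z^N\<close> as combinations of the entries of a single column.\<close>

lemma third_nonzero_entry:
  assumes j: "j < nc" and rs: "r < nb" "s < nb" "r \<noteq> s"
  shows "\<exists>t<nb. t \<noteq> r \<and> t \<noteq> s \<and> D2 $$ (t, j) \<noteq> 0"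
proof (rule ccontr)
  assume n: "\<not> ?thesis"
  have "\<exists>f g. var i ^ N = f * D2 $$ (r, j) + g * D2 $$ (s, j)" for i
  proof -
    obtain h0 h1 h2 where h: "homotopy (var i ^ N) h0 h1 h2" by (rule homotopy_var)
    then have c: "h2 \<in> carrier_mat nc nb" and e: "h2 * D2 = var i ^ N \<cdot>\<^sub>m 1\<^sub>m nc"
      by (auto simp: homotopy_def)
    have "var i ^ N = (\<Sum>t = 0..<nb. h2 $$ (j, t) * D2 $$ (t, j))"
      using arg_cong[OF e, of "\<lambda>M. M $$ (j, j)"] j c by (simp add: scalar_prod_def)
    also have "\<dots> = (\<Sum>t\<in>{r, s}. h2 $$ (j, t) * D2 $$ (t, j))"
      using rs n by (intro sum.mono_neutral_right) auto
    finally show ?thesis using rs(3) by auto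
  qed
  then obtain f g where "\<And>i. var i ^ N = f i * D2 $$ (r, j) + g i * D2 $$ (s, j)" by metis
  then show False by (rule two_generators_not_all_var_powers[OF minimal2 minimal2, rotated 4]) (use j rs in auto)
qed

text \<open>Exchanging the two entries in column \<open>j\<close>, with one sign changed, gives a cocycle \<open>w\<close> of the dual complex.
  It is homogeneous and lies in the image of the transposed \<open>D1\<close>. If the inequality failed for all
  \<open>i\<close>, then all coordinates of a homogeneous preimage would have negative degree, so \<open>w\<close> would vanish and
  row \<open>r\<close> would be zero.\<close>

lemma two_rows_one_column_bound:
  assumes rs: "r < nb" "s < nb" "r \<noteq> s" and j: "j < nc"
    and z: "\<And>k. k < nc \<Longrightarrow> k \<noteq> j \<Longrightarrow> D2 $$ (r, k) = 0 \<and> D2 $$ (s, k) = 0"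
  shows "\<exists>i<na. b ! r + b ! s \<le> c ! j + a ! i"
proof (rule ccontr)
  assume "\<not> ?thesis"
  then have neg: "c ! j - b ! r - b ! s + a ! i < 0" if "i < na" for i using that by force
  define w where "w = vec nb (\<lambda>k. if k = r then D2 $$ (s, j) else if k = s then - D2 $$ (r, j) else 0)"
  have "(transpose_mat D2 *\<^sub>v w) $ k = 0" if k: "k < nc" for k
  proof -
    have "(transpose_mat D2 *\<^sub>v w) $ k = (\<Sum>i = 0..<nb. D2 $$ (i, k) * w $ i)"
      using k by (simp add: scalar_prod_def w_def)
    also have "\<dots> = (\<Sum>i\<in>{r, s}. D2 $$ (i, k) * w $ i)"
      using rs by (intro sum.mono_neutral_right) (auto simp: w_def)
    also have "\<dots> = D2 $$ (r, k) * D2 $$ (s, j) - D2 $$ (s, k) * D2 $$ (r, j)"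
      using rs by (simp add: w_def)
    also have "\<dots> = 0" using z[OF k] by (cases "k = j") auto
    finally show ?thesis .
  qed
  then have "transpose_mat D2 *\<^sub>v w = 0\<^sub>v nc" by (intro eq_vecI) auto
  then have "w \<in> mat_kernel (transpose_mat D2)" by (simp add: mat_kernel_def w_def)
  then have im: "w \<in> mat_image (transpose_mat D1)" using dual_exact by blast
  have gr: "graded_map (map uminus a) (map uminus b) (transpose_mat D1)"
    using graded_mapD(2)[OF D1] by (auto simp: graded_map_def)
  have hom: "homogeneous_of_degree ((c ! j - b ! r - b ! s) - map uminus b ! k) (w $ k)" if "k < length (map uminus b)" for k
    using that rs j graded_mapD(2)[OF D2, of s j] graded_mapD(2)[OF D2, of r j] by (auto simp: w_def)
  obtain v where v: "v \<in> carrier_vec (length (map uminus a))" "transpose_mat D1 *\<^sub>v v = w"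
      "\<And>i. i < length (map uminus a) \<Longrightarrow> homogeneous_of_degree ((c ! j - b ! r - b ! s) - map uminus a ! i) (v $ i)"
    using graded_preimage[OF gr im hom] by blast
  have "v $ i = 0" if "i < na" for i
    using homogeneous_negative_degree[OF v(3)[of i]] neg[OF that] that by simp
  then have "v = 0\<^sub>v na" using v(1) by (intro eq_vecI) auto
  then have "w = 0\<^sub>v nb" unfolding v(2)[symmetric] by (intro eq_vecI) auto
  then have "w $ s = 0" using rs by simp
  then have "D2 $$ (r, j) = 0" using rs by (simp add: w_def)
  then show False using no_zero_row[OF rs(1)] z by metis
qed

text \<open>A zero generator would make a basis vector a syzygy, contrary to minimality.\<close>

lemma generator_neq_0:
  assumes j: "j < na"
  shows "D0 $$ (0, j) \<noteq> 0"
proof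
  assume z: "D0 $$ (0, j) = 0"
  have "D0 *\<^sub>v unit_vec na j = 0\<^sub>v 1" using j z by (intro eq_vecI) auto
  then have "unit_vec na j \<in> mat_kernel D0" by (simp add: mat_kernel_def)
  then obtain w where w: "w \<in> carrier_vec nb" "unit_vec na j = D1 *\<^sub>v w"
    unfolding exact0 by (auto simp: mat_image_def)
  have e: "1 = (\<Sum>i = 0..<nb. D1 $$ (j, i) * w $ i)"
    using arg_cong[OF w(2), of "\<lambda>u. u $ j"] j w(1) by (simp add: scalar_prod_def)
  have "Poly_Mapping.lookup (1 :: 'k poly3) 0 = (\<Sum>i = 0..<nb. Poly_Mapping.lookup (D1 $$ (j, i) * w $ i) 0)"
    unfolding lookup_sum[symmetric] by (rule arg_cong[OF e])
  also have "\<dots> = 0" using minimal1 j by (simp add: const_term_mult)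
  finally show False by simp
qed

text \<open>If one generator were a nonzero constant, then its Koszul syzygy with a second generator would
  have a constant entry.\<close>

lemma generator_degree_pos:
  assumes j: "j < na" and na: "2 \<le> na"
  shows "0 < a ! j"
proof (rule ccontr)
  assume "\<not> 0 < a ! j"
  moreover have hom: "homogeneous_of_degree (a ! j) (D0 $$ (0, j))"
    using graded_mapD(2)[OF D0, of 0 j] j by simp
  ultimately have const: "Poly_Mapping.lookup (D0 $$ (0, j)) 0 \<noteq> 0"
    using homogeneous_nonpos_degree[OF hom] generator_neq_0[OF j] by fastforce
  obtain l where l: "l < na" "l \<noteq> j" using na by (cases "j = 0") (auto intro: that[of 0] that[of 1])
  define v where "v = vec na (\<lambda>i. if i = j then D0 $$ (0, l) else if i = l then - D0 $$ (0, j) else 0)"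
  have "(D0 *\<^sub>v v) $ 0 = (\<Sum>i = 0..<na. D0 $$ (0, i) * v $ i)" by (simp add: scalar_prod_def v_def)
  also have "\<dots> = (\<Sum>i\<in>{j, l}. D0 $$ (0, i) * v $ i)"
    using j l by (intro sum.mono_neutral_right) (auto simp: v_def)
  also have "\<dots> = 0" using j l by (simp add: v_def)
  finally have "D0 *\<^sub>v v = 0\<^sub>v 1" by (intro eq_vecI) auto
  then have "v \<in> mat_kernel D0" by (simp add: mat_kernel_def v_def)
  then obtain w where w: "w \<in> carrier_vec nb" "v = D1 *\<^sub>v w"
    unfolding exact0 by (auto simp: mat_image_def)
  have "- D0 $$ (0, j) = (\<Sum>i = 0..<nb. D1 $$ (l, i) * w $ i)"
    using arg_cong[OF w(2), of "\<lambda>u. u $ l"] l w(1) by (simp add: scalar_prod_def v_def)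
  then have "- Poly_Mapping.lookup (D0 $$ (0, j)) 0 = (\<Sum>i = 0..<nb. Poly_Mapping.lookup (D1 $$ (l, i) * w $ i) 0)"
    unfolding lookup_sum[symmetric] lookup_uminus[symmetric] by (rule arg_cong)
  also have "\<dots> = 0" using minimal1 l by (simp add: const_term_mult)
  finally show False using const by simp
qed

end

section \<open>The numerical constraints in type two\<close>

lemma nth_of_mset_eq:
  assumes "mset xs = mset ys"
  obtains p where "p permutes {..<length ys}" "\<And>i. i < length ys \<Longrightarrow> xs ! i = ys ! p i"
proof -
  obtain p where "p permutes {..<length ys}" "permute_list p ys = xs"
    using mset_eq_permutation[OF assms] by blast
  then show thesis using that[of p] by (auto simp: permute_list_nth)
qed

context minimal_finite_length_resolution
begin

text \<open>If \<open>s2 \<le> d3\<close>, then the row of \<open>D2\<close> with shift \<open>d3 + dst\<close> vanishes for degree reasons. If \<open>s1 \<le> d2\<close>, then in the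
  column with shift \<open>s1 + dst\<close> the rows with shifts \<open>d2 + dst\<close> and \<open>d3 + dst\<close> are zero. The three other
  entries of this column are then nonzero, which gives \<open>d1 < s1\<close> and \<open>s2 < s1 + dst\<close>. These two
  inequalities contradict the bound for two rows supported in one column.\<close>

lemma type_two_shift_bounds:
  fixes d d1 d2 d3 dst s1 s2 :: nat
  assumes a: "mset a = image_mset int {#d1, d2, d3, dst#}"
    and b: "mset b = image_mset int {#s1, s2, d1 + dst, d2 + dst, d3 + dst#}"
    and c: "mset c = {#int d - int s1, int d - int s2#}"
    and d: "d = d1 + d2 + d3 + dst" and ord: "d1 \<le> d2" "d2 \<le> d3" "s1 \<le> s2"
  shows "0 < dst \<and> s1 + s2 = d1 + d2 + d3 \<and> d3 < s2 \<and> d2 < s1"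
proof -
  have len: "na = 4" "nb = 5" "nc = 2"
    using arg_cong[OF a, of size] arg_cong[OF b, of size] arg_cong[OF c, of size] by simp_all
  have "sum_list a = int (d1 + d2 + d3 + dst)" using arg_cong[OF a, of sum_mset] by (simp add: sum_mset_sum_list)
  moreover have "sum_list b = int (s1 + s2 + (d1 + dst) + (d2 + dst) + (d3 + dst))"
    using arg_cong[OF b, of sum_mset] by (simp add: sum_mset_sum_list)
  moreover have "sum_list c = 2 * int d - int s1 - int s2"
    using arg_cong[OF c, of sum_mset] by (simp add: sum_mset_sum_list)
  moreover have "sum_list a + sum_list c = sum_list b"
    by (rule shift_sum[OF var_powers[of 0] var_powers[of 1]]) (use len in simp_all)
  ultimately have sum: "s1 + s2 = d1 + d2 + d3" unfolding d by simp
  have "int dst \<in># mset a" using a by simp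
  then obtain j where "j < na" "a ! j = int dst" by (auto simp: in_set_conv_nth)
  then have pos: "0 < dst" using generator_degree_pos[of j] len by simp
  have c_cases: "c ! k = int s2 + int dst \<or> c ! k = int s1 + int dst" if "k < nc" for k
  proof -
    have "c ! k \<in># mset c" using that by simp
    then show ?thesis unfolding c using sum d by auto
  qed
  \<comment> \<open>\<open>p\<close> locates the rows of \<open>D2\<close> with shifts \<open>s1\<close>, \<open>s2\<close>, \<open>d1 + dst\<close>, \<open>d2 + dst\<close>, \<open>d3 + dst\<close>, in this order.\<close>
  have "mset [int s1, int s2, int (d1 + dst), int (d2 + dst), int (d3 + dst)] = mset b"
    unfolding b by simp
  from nth_of_mset_eq[OF this] obtain p where p: "p permutes {..<nb}"
    "\<And>i. i < nb \<Longrightarrow> [int s1, int s2, int (d1 + dst), int (d2 + dst), int (d3 + dst)] ! i = b ! p i" by blast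
  have pb: "b ! p 0 = s1" "b ! p 1 = s2" "b ! p 2 = d1 + dst" "b ! p 3 = d2 + dst" "b ! p 4 = d3 + dst"
    using p(2)[of 0] p(2)[of 1] p(2)[of 2] p(2)[of 3] p(2)[of 4] len by (simp_all add: nth_Cons')
  have pl: "p i < nb" if "i < nb" for i using permutes_in_image[OF p(1), of i] that by simp
  have pi: "p i = p j \<longleftrightarrow> i = j" for i j using permutes_inj[OF p(1)] by (auto simp: inj_def)
  have ps: "\<exists>i<nb. t = p i" if "t < nb" for t
    using permutes_surj[OF p(1)] permutes_in_image[OF p(1)] that by (metis lessThan_iff surjD)
  have s2: "d3 < s2"
  proof (rule ccontr)
    assume "\<not> d3 < s2"
    then have "D2 $$ (p 4, k) = 0" if "k < nc" for k
      using c_cases[OF that] ord pb(5) that len by (intro D2_entry_0 pl) auto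
    then show False using no_zero_row[OF pl[of 4]] len by auto
  qed
  have s1: "d2 < s1"
  proof (rule ccontr)
    assume n: "\<not> d2 < s1"
    have "int d - int s1 = int s2 + int dst" "int d - int s2 = int s1 + int dst" using sum d by simp_all
    \<comment> \<open>\<open>q\<close> locates the columns with shifts \<open>s1 + dst\<close> and \<open>s2 + dst\<close>, in this order.\<close>
    then have "mset [int s1 + int dst, int s2 + int dst] = mset c" unfolding c by simp
    from nth_of_mset_eq[OF this] obtain q where q: "q permutes {..<nc}"
      "\<And>i. i < nc \<Longrightarrow> [int s1 + int dst, int s2 + int dst] ! i = c ! q i" by blast
    have qc: "c ! q 0 = s1 + dst" "c ! q 1 = s2 + dst" using q(2)[of 0] q(2)[of 1] len by simp_all
    have ql: "q i < nc" if "i < nc" for i using permutes_in_image[OF q(1), of i] that by simp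
    have q01: "k = q 0" if "k < nc" "k \<noteq> q 1" for k
    proof -
      obtain i where "k = q i" "i < nc"
        using permutes_surj[OF q(1)] permutes_in_image[OF q(1)] \<open>k < nc\<close> by (metis lessThan_iff surjD)
      then show ?thesis using that len by (metis less_2_cases One_nat_def)
    qed
    have z: "D2 $$ (p 3, q 0) = 0" "D2 $$ (p 4, q 0) = 0"
      using n ord pb(4,5) qc(1) len by (auto intro!: D2_entry_0 pl ql)
    have nz: "D2 $$ (p i, q 0) \<noteq> 0"
      if ikl: "i < 3" "k < 3" "l < 3" "k \<noteq> l" "i \<noteq> k" "i \<noteq> l" for i k l
    proof -
      have "p k < nb" "p l < nb" "p k \<noteq> p l" using ikl len pl pi by auto
      then obtain t where t: "t < nb" "t \<noteq> p k" "t \<noteq> p l" "D2 $$ (t, q 0) \<noteq> 0"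
        using third_nonzero_entry[of "q 0" "p k" "p l"] ql[of 0] len by auto
      obtain m where m: "m < nb" "t = p m" using ps[OF t(1)] by blast
      have "m \<noteq> 3" "m \<noteq> 4" "m \<noteq> k" "m \<noteq> l" using t(2-4) z m by auto
      moreover have "m < 5" using m(1) len by simp
      ultimately have "m = i" using ikl by arith
      then show ?thesis using t(4) m(2) by simp
    qed
    have lt: "b ! p i < c ! q 0" if "D2 $$ (p i, q 0) \<noteq> 0" "i < 3" for i
    proof -
      have "p i < nb" "q 0 < nc" using pl[of i] ql[of 0] that(2) len by auto
      then show ?thesis using D2_entry_0[of "p i" "q 0"] that(1) not_le by blast
    qed
    have "s2 < s1 + dst" "d1 < s1"
      using lt[OF nz[of 1 0 2]] lt[OF nz[of 2 0 1]] pb qc by simp_all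
    moreover obtain j where "j < na" "b ! p 3 + b ! p 4 \<le> c ! q 1 + a ! j"
    proof -
      have "D2 $$ (p 3, k) = 0 \<and> D2 $$ (p 4, k) = 0" if "k < nc" "k \<noteq> q 1" for k
        using q01[OF that] z by simp
      then show thesis
        using that two_rows_one_column_bound[of "p 3" "p 4" "q 1"] pl[of 3] pl[of 4] ql[of 1] pi len by auto
    qed
    moreover have "a ! j \<in># mset a" using \<open>j < na\<close> by simp
    then have "a ! j \<in> {int d1, int d2, int d3, int dst}" unfolding a by simp
    ultimately show False using pb(4,5) qc(2) sum ord n by auto
  qed
  from pos sum s1 s2 show ?thesis by simp
qed

end

section \<open>Ideals of finite colength\<close>

lemma module_self: "Modules.module ((*) :: 'a::comm_ring_1 \<Rightarrow> 'a \<Rightarrow> 'a)"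
  by unfold_locales (simp_all add: algebra_simps)

lemma is_ideal_iff:
  "is_ideal S \<longleftrightarrow> 0 \<in> S \<and> (\<forall>x\<in>S. \<forall>y\<in>S. x + y \<in> S) \<and> (\<forall>c. \<forall>x\<in>S. c * x \<in> S)"
  unfolding is_ideal_def by (rule Modules.module.subspace_def[OF module_self])

context short_resolution
begin

lemma ideal_mem: "g \<in> ideal \<longleftrightarrow> (\<exists>v\<in>carrier_vec na. g = (\<Sum>j<na. D0 $$ (0, j) * v $ j))"
proof -
  have "(D0 *\<^sub>v v) $ 0 = (\<Sum>j<na. D0 $$ (0, j) * v $ j)" if "v \<in> carrier_vec na" for v
    using that by (simp add: scalar_prod_def lessThan_atLeast0)
  then show ?thesis by (auto simp: ideal_def mat_image_def image_iff)
qed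

lemma is_ideal_ideal: "is_ideal ideal"
  unfolding is_ideal_iff
proof (intro conjI ballI allI)
  show "0 \<in> ideal" unfolding ideal_mem by (rule bexI[of _ "0\<^sub>v na"]) auto
next
  fix x y assume "x \<in> ideal" "y \<in> ideal"
  then obtain v w where "v \<in> carrier_vec na" "x = (\<Sum>j<na. D0 $$ (0, j) * v $ j)"
    "w \<in> carrier_vec na" "y = (\<Sum>j<na. D0 $$ (0, j) * w $ j)" unfolding ideal_mem by blast
  then show "x + y \<in> ideal" unfolding ideal_mem
    by (intro bexI[of _ "v + w"]) (auto simp: sum.distrib distrib_left)
next
  fix g x assume "x \<in> ideal"
  then obtain v where "v \<in> carrier_vec na" "x = (\<Sum>j<na. D0 $$ (0, j) * v $ j)" unfolding ideal_mem by blast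
  then show "g * x \<in> ideal" unfolding ideal_mem
    by (intro bexI[of _ "g \<cdot>\<^sub>v v"]) (auto simp: sum_distrib_left mult_ac)
qed

lemma hom_component_ideal:
  assumes "g \<in> ideal"
  shows "hom_component n g \<in> ideal"
proof -
  obtain v where v: "v \<in> carrier_vec na" "g = (\<Sum>j<na. D0 $$ (0, j) * v $ j)"
    using assms unfolding ideal_mem by blast
  have "hom_component n g = (\<Sum>j<na. D0 $$ (0, j) * hom_component (n - a ! j) (v $ j))"
    unfolding v(2) hom_component_sum
    using graded_mapD(2)[OF D0, of 0] by (intro sum.cong hom_component_mult) auto
  then show ?thesis
    unfolding ideal_mem by (intro bexI[of _ "vec na (\<lambda>j. hom_component (n - a ! j) (v $ j))"]) auto
qed

text \<open>The chain of ideals \<open>I + (x^n)\<close> becomes stationary, so \<open>x^n\<close> lies in \<open>I + (x^(n+1))\<close> for some \<open>n\<close>. Taking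
  the component of degree \<open>n\<close> removes the second summand, as \<open>I\<close> is homogeneous.\<close>

lemma artinian_var_powers:
  assumes "artinian_quotient ideal"
  shows "\<exists>N. \<forall>i. var i ^ N \<in> ideal"
proof -
  note I = is_ideal_ideal[unfolded is_ideal_iff]
  have "\<exists>n. var i ^ n \<in> ideal" for i
  proof -
    define K where "K n = {p + q * var i ^ n | p q. p \<in> ideal}" for n
    have "is_ideal (K n) \<and> ideal \<subseteq> K n \<and> K (Suc n) \<subseteq> K n" for n
    proof (intro conjI)
      show "is_ideal (K n)"
        unfolding is_ideal_iff
      proof (intro conjI ballI allI)
        show "0 \<in> K n" unfolding K_def using I by (auto intro!: exI[of _ 0])
      next
        fix x y assume "x \<in> K n" "y \<in> K n"
        then obtain p q p' q' where "x = p + q * var i ^ n" "y = p' + q' * var i ^ n" "p \<in> ideal" "p' \<in> ideal"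
          unfolding K_def by blast
        then have "x + y = (p + p') + (q + q') * var i ^ n" "p + p' \<in> ideal"
          using I by (auto simp: algebra_simps)
        then show "x + y \<in> K n" unfolding K_def by blast
      next
        fix g x assume "x \<in> K n"
        then obtain p q where "x = p + q * var i ^ n" "p \<in> ideal" unfolding K_def by blast
        then have "g * x = g * p + (g * q) * var i ^ n" "g * p \<in> ideal"
          using I by (auto simp: algebra_simps)
        then show "g * x \<in> K n" unfolding K_def by blast
      qed
      show "ideal \<subseteq> K n"
      proof
        fix x assume "x \<in> ideal"
        moreover have "x = x + 0 * var i ^ n" by simp
        ultimately show "x \<in> K n" unfolding K_def by blast
      qed
      show "K (Suc n) \<subseteq> K n"
      proof
        fix x assume "x \<in> K (Suc n)"
        then obtain p q where "x = p + (q * var i) * var i ^ n" "p \<in> ideal" unfolding K_def by (auto simp: mult_ac)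
        then show "x \<in> K n" unfolding K_def by blast
      qed
    qed
    then obtain n where n: "\<And>m. m \<ge> n \<Longrightarrow> K m = K n"
      using assms unfolding artinian_quotient_def by blast
    have "var i ^ n = 0 + 1 * var i ^ n" by simp
    then have "var i ^ n \<in> K n" unfolding K_def using I by blast
    then have "var i ^ n \<in> K (Suc n)" using n[of "Suc n"] by simp
    then obtain p q where pq: "var i ^ n = p + var i ^ Suc n * q" "p \<in> ideal"
      unfolding K_def by (auto simp: mult_ac)
    have "var i ^ n = hom_component (int n) (p + var i ^ Suc n * q)"
      unfolding pq(1)[symmetric] by (simp add: hom_component_id)
    also have "\<dots> = hom_component (int n) p + var i ^ Suc n * hom_component (int n - int (Suc n)) q"
      unfolding hom_component_add hom_component_mult[OF homogeneous_of_degree_var_power] ..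
    also have "hom_component (int n - int (Suc n)) q = 0"
      using homogeneous_negative_degree[OF hom_component_homogeneous[of "int n - int (Suc n)" q]] by simp
    finally have "var i ^ n = hom_component (int n) p" by simp
    then show ?thesis using hom_component_ideal[OF pq(2)] by metis
  qed
  then obtain n where n: "\<And>i. var i ^ n i \<in> ideal" by metis
  have "var i ^ (\<Sum>i\<in>UNIV. n i) \<in> ideal" for i
  proof -
    have "(\<Sum>i\<in>UNIV. n i) = ((\<Sum>i\<in>UNIV. n i) - n i) + n i"
      using member_le_sum[of i UNIV n] by simp
    then have "var i ^ (\<Sum>i\<in>UNIV. n i) = var i ^ ((\<Sum>i\<in>UNIV. n i) - n i) * var i ^ n i"
      by (metis power_add)
    then show ?thesis using I n[of i] by metis
  qed
  then show ?thesis by blast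
qed

end

lemma short_resolution_of_minimal:
  fixes D :: "nat \<Rightarrow> 'k::field poly3 mat"
  assumes R: "minimal_graded_free_resolution F D I" and F3: "F 3 = []"
  shows "short_resolution (F 0) (F 1) (F 2) (D 0) (D 1) (D 2)"
proof
  note r = resolution_maps[OF R]
  show "graded_map (F 0) [0] (D 0)" by (rule r)
  show "graded_map (F 1) (F 0) (D 1)" using r(2)[of 0] by (simp add: One_nat_def)
  show "graded_map (F 2) (F 1) (D 2)" using r(2)[of 1] by (simp add: numeral_2_eq_2 One_nat_def)
  show "mat_kernel (D 0) = mat_image (D 1)" using r(3)[of 0] by (simp add: One_nat_def)
  show "mat_kernel (D 1) = mat_image (D 2)" using r(3)[of 1] by (simp add: numeral_2_eq_2 One_nat_def)
  have D3: "D 3 \<in> carrier_mat (length (F 2)) 0"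
    using r(4)[of 2] F3 by (simp add: numeral_3_eq_3 numeral_2_eq_2)
  have e: "D 3 *\<^sub>v v = 0\<^sub>v (length (F 2))" if "v \<in> carrier_vec 0" for v
    using D3 that by (intro eq_vecI) (auto simp: scalar_prod_def)
  have "mat_image (D 3) = {0\<^sub>v (length (F 2))}"
    using D3 e e[of "0\<^sub>v 0"] unfolding mat_image_def by (auto intro!: exI[of _ "0\<^sub>v 0"])
  then show "mat_kernel (D 2) = {0\<^sub>v (length (F 2))}"
    using r(3)[of 2] by (simp add: numeral_3_eq_3 numeral_2_eq_2)
qed

section \<open>The resolution of the monomial ideal\<close>

lemma sum_upt_2: "sum f {0..<2::nat} = f 0 + f 1"
  and sum_upt_4: "sum f {0..<4::nat} = f 0 + f 1 + f 2 + f 3"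
  and sum_upt_5: "sum f {0..<5::nat} = f 0 + f 1 + f 2 + f 3 + f 4"
  for f :: "nat \<Rightarrow> 'a::comm_monoid_add"
  by (simp_all add: eval_nat_numeral One_nat_def add_ac)

lemma less_4_cases: "(i::nat) < 4 \<longleftrightarrow> i = 0 \<or> i = 1 \<or> i = 2 \<or> i = 3"
  and less_5_cases: "(i::nat) < 5 \<longleftrightarrow> i = 0 \<or> i = 1 \<or> i = 2 \<or> i = 3 \<or> i = 4"
  and less_2_cases': "(i::nat) < 2 \<longleftrightarrow> i = 0 \<or> i = 1"
  by auto

lemma mat_mult_vec_entries:
  "w \<in> carrier_vec m \<Longrightarrow> mat n m f *\<^sub>v w = vec n (\<lambda>i. \<Sum>j = 0..<m. f (i, j) * w $ j)"
  by (intro eq_vecI) (auto simp: scalar_prod_def)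

text \<open>
  The exponents are parametrised so that the resolution below has only monomial entries without
  subtraction in the exponents: the ideal is \<open>(x^(a+u), y^(b+v), x^a y^b, z^c)\<close>.
\<close>

locale monomial_ideal =
  fixes a u b v c :: nat
  assumes pos: "0 < a" "0 < u" "0 < b" "0 < v" "0 < c"
begin

text \<open>The tensor product of the Hilbert-Burch resolution of \<open>(x^(a+u), y^(b+v), x^a y^b)\<close> with the Koszul
  complex of \<open>z^c\<close>. The first two columns of \<open>E1\<close> are the Hilbert-Burch syzygies, the others are the
  Koszul syzygies with \<open>z^c\<close>.\<close>

definition E0 :: "'k::field poly3 mat"
  where "E0 = mat 1 4 (\<lambda>(i, j). [[X ^ (a + u), Y ^ (b + v), X ^ a * Y ^ b, Z ^ c]] ! i ! j)"

definition E1 :: "'k::field poly3 mat"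
  where "E1 = mat 4 5 (\<lambda>(i, j). [[Y ^ b, 0, Z ^ c, 0, 0],
     [0, X ^ a, 0, Z ^ c, 0],
     [- (X ^ u), - (Y ^ v), 0, 0, Z ^ c],
     [0, 0, - (X ^ (a + u)), - (Y ^ (b + v)), - (X ^ a * Y ^ b)]] ! i ! j)"

definition E2 :: "'k::field poly3 mat"
  where "E2 = mat 5 2 (\<lambda>(i, j). [[Z ^ c, 0], [0, Z ^ c], [- (Y ^ b), 0], [0, - (X ^ a)], [X ^ u, Y ^ v]] ! i ! j)"

lemma E0_mult: "w \<in> carrier_vec 4 \<Longrightarrow> E0 *\<^sub>v w =
    vec 1 (\<lambda>_. X ^ (a + u) * w $ 0 + Y ^ (b + v) * w $ 1 + X ^ a * Y ^ b * w $ 2 + Z ^ c * w $ 3)"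
  by (intro eq_vecI) (auto simp: E0_def mat_mult_vec_entries sum_upt_4 nth_Cons')

lemma E1_mult: "w \<in> carrier_vec 5 \<Longrightarrow> E1 *\<^sub>v w = vec 4 (\<lambda>i.
    [Y ^ b * w $ 0 + Z ^ c * w $ 2, X ^ a * w $ 1 + Z ^ c * w $ 3,
     - (X ^ u) * w $ 0 - Y ^ v * w $ 1 + Z ^ c * w $ 4,
     - (X ^ (a + u)) * w $ 2 - Y ^ (b + v) * w $ 3 - X ^ a * Y ^ b * w $ 4] ! i)"
  by (intro eq_vecI) (auto simp: E1_def mat_mult_vec_entries sum_upt_5 nth_Cons' less_4_cases)

lemma E2_mult: "w \<in> carrier_vec 2 \<Longrightarrow> E2 *\<^sub>v w = vec 5 (\<lambda>i.
    [Z ^ c * w $ 0, Z ^ c * w $ 1, - (Y ^ b) * w $ 0, - (X ^ a) * w $ 1, X ^ u * w $ 0 + Y ^ v * w $ 1] ! i)"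
  by (intro eq_vecI) (auto simp: E2_def mat_mult_vec_entries sum_upt_2 nth_Cons' less_5_cases)

text \<open>Reducing a syzygy modulo \<open>z^c\<close> gives a syzygy \<open>(r 0, r 1, r 2)\<close> of the first three generators, which is
  a combination of the two Hilbert-Burch syzygies by coprimality of powers of \<open>x\<close> and \<open>y\<close>. The quotients
  \<open>q 0, q 1, q 2\<close> are the coefficients of the Koszul syzygies.\<close>

lemma exact_E0: "mat_kernel E0 = mat_image (E1 :: 'k::field poly3 mat)"
proof (intro equalityI subsetI)
  fix w :: "'k poly3 vec"
  assume "w \<in> mat_image E1"
  then obtain t where t: "t \<in> carrier_vec 5" "w = E1 *\<^sub>v t" by (auto simp: mat_image_def E1_def)
  have "w \<in> carrier_vec 4" using t(2) E1_mult[OF t(1)] by simp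
  moreover have "E0 *\<^sub>v w = 0\<^sub>v 1"
    unfolding E0_mult[OF \<open>w \<in> carrier_vec 4\<close>] unfolding t(2) E1_mult[OF t(1)]
    by (intro eq_vecI) (simp_all add: nth_Cons' power_add algebra_simps)
  ultimately show "w \<in> mat_kernel E0" by (simp add: mat_kernel_def E0_def)
next
  fix w :: "'k poly3 vec"
  assume "w \<in> mat_kernel E0"
  then have w: "w \<in> carrier_vec 4" "E0 *\<^sub>v w = 0\<^sub>v 1" by (auto simp: mat_kernel_def E0_def)
  have e: "X ^ (a + u) * w $ 0 + Y ^ (b + v) * w $ 1 + X ^ a * (Y ^ b * w $ 2) + Z ^ c * w $ 3 = 0"
    using arg_cong[OF w(2), of "\<lambda>t. t $ 0"] unfolding E0_mult[OF w(1)] by (simp add: mult.assoc)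
  define r where "r i = var_remainder 2 c (w $ i)" for i
  have "\<exists>q. w $ i = r i + Z ^ c * q" for i unfolding r_def by (rule var_remainder_decomp)
  then obtain q where q: "\<And>i. w $ i = r i + Z ^ c * q i" by metis
  have "X ^ (a + u) * r 0 + Y ^ (b + v) * r 1 + X ^ a * (Y ^ b * r 2) = 0"
    using arg_cong[OF e, of "var_remainder 2 c"]
    unfolding var_remainder_add var_remainder_multiple r_def
    by (simp add: var_remainder_other_var) (simp add: var_remainder_def)
  then have r0: "X ^ a * (X ^ u * r 0 + Y ^ b * r 2) = Y ^ (b + v) * (- r 1)"
    by (simp add: power_add algebra_simps add_eq_0_iff)
  obtain h where h: "X ^ u * r 0 + Y ^ b * r 2 = Y ^ (b + v) * h" "- r 1 = X ^ a * h"
    by (rule var_powers_coprime[OF r0]) simp_all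
  have "X ^ u * r 0 = Y ^ b * (Y ^ v * h - r 2)"
    using h(1) by (simp add: power_add algebra_simps)
  then obtain k where k: "r 0 = Y ^ b * k" "Y ^ v * h - r 2 = X ^ u * k"
    by (rule var_powers_coprime) simp_all
  have r1: "r 1 = - (X ^ a * h)" and r2: "r 2 = Y ^ v * h - X ^ u * k"
    using h(2) k(2) by (metis minus_minus, simp add: algebra_simps)
  have w3: "w $ 3 = - (X ^ (a + u) * q 0) - Y ^ (b + v) * q 1 - X ^ a * (Y ^ b * q 2)"
  proof -
    have "Z ^ c * (w $ 3 + (X ^ (a + u) * q 0 + Y ^ (b + v) * q 1 + X ^ a * (Y ^ b * q 2))) = 0"
      using e unfolding q[of 0] q[of 1] q[of 2] k(1) r1 r2 by (simp add: power_add algebra_simps)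
    then have "w $ 3 + (X ^ (a + u) * q 0 + Y ^ (b + v) * q 1 + X ^ a * (Y ^ b * q 2)) = 0" by simp
    then show ?thesis by (simp add: eq_neg_iff_add_eq_0 algebra_simps)
  qed
  define t where "t = vec 5 (\<lambda>i. [k, - h, q 0, q 1, q 2] ! i)"
  have t: "t \<in> carrier_vec 5" "t $ 0 = k" "t $ 1 = - h" "t $ 2 = q 0" "t $ 3 = q 1" "t $ 4 = q 2"
    by (simp_all add: t_def nth_Cons')
  have "w = E1 *\<^sub>v t"
    unfolding E1_mult[OF t(1)] t(2-) using w(1) w3 q[of 0] q[of 1] q[of 2] k(1) r1 r2
    by (intro eq_vecI) (auto simp: less_4_cases nth_Cons' algebra_simps)
  then show "w \<in> mat_image E1" using t(1) by (auto simp: mat_image_def E1_def)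
qed

text \<open>The first two coordinates are divisible by \<open>z^c\<close>, and the two quotients determine the others.\<close>

lemma exact_E1: "mat_kernel E1 = mat_image (E2 :: 'k::field poly3 mat)"
proof (intro equalityI subsetI)
  fix w :: "'k poly3 vec"
  assume "w \<in> mat_image E2"
  then obtain t where t: "t \<in> carrier_vec 2" "w = E2 *\<^sub>v t" by (auto simp: mat_image_def E2_def)
  have "w \<in> carrier_vec 5" using t(2) E2_mult[OF t(1)] by simp
  moreover have "E1 *\<^sub>v w = 0\<^sub>v 4"
    unfolding E1_mult[OF \<open>w \<in> carrier_vec 5\<close>] unfolding t(2) E2_mult[OF t(1)]
    by (intro eq_vecI) (auto simp: nth_Cons' less_4_cases power_add algebra_simps)
  ultimately show "w \<in> mat_kernel E1" by (simp add: mat_kernel_def E1_def)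
next
  fix w :: "'k poly3 vec"
  assume "w \<in> mat_kernel E1"
  then have w: "w \<in> carrier_vec 5" "E1 *\<^sub>v w = 0\<^sub>v 4" by (auto simp: mat_kernel_def E1_def)
  have e: "Y ^ b * w $ 0 + Z ^ c * w $ 2 = 0" "X ^ a * w $ 1 + Z ^ c * w $ 3 = 0"
     "- (X ^ u) * w $ 0 - Y ^ v * w $ 1 + Z ^ c * w $ 4 = 0"
    using arg_cong[OF w(2), of "\<lambda>t. t $ 0"] arg_cong[OF w(2), of "\<lambda>t. t $ 1"] arg_cong[OF w(2), of "\<lambda>t. t $ 2"]
    unfolding E1_mult[OF w(1)] by (simp_all add: nth_Cons')
  have "Y ^ b * w $ 0 = Z ^ c * (- w $ 2)" using e(1) by (simp add: add_eq_0_iff)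
  then obtain f where f: "w $ 0 = Z ^ c * f" "- w $ 2 = Y ^ b * f" by (rule var_powers_coprime) simp_all
  have "X ^ a * w $ 1 = Z ^ c * (- w $ 3)" using e(2) by (simp add: add_eq_0_iff)
  then obtain g where g: "w $ 1 = Z ^ c * g" "- w $ 3 = X ^ a * g" by (rule var_powers_coprime) simp_all
  have "Z ^ c * (w $ 4 - (X ^ u * f + Y ^ v * g)) = 0"
    using e(3) unfolding f(1) g(1) by (simp add: algebra_simps)
  then have w4: "w $ 4 = X ^ u * f + Y ^ v * g" by simp
  have w23: "w $ 2 = - (Y ^ b * f)" "w $ 3 = - (X ^ a * g)" using f(2) g(2) by (metis minus_minus)+
  define t where "t = vec 2 (\<lambda>i. [f, g] ! i)"
  have t: "t \<in> carrier_vec 2" "t $ 0 = f" "t $ 1 = g" by (simp_all add: t_def nth_Cons')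
  have "w = E2 *\<^sub>v t"
    unfolding E2_mult[OF t(1)] t(2-) using w(1) w4 w23 f(1) g(1)
    by (intro eq_vecI) (auto simp: less_5_cases nth_Cons')
  then show "w \<in> mat_image E2" using t(1) by (auto simp: mat_image_def E2_def)
qed

lemma inj_E2: "mat_kernel (E2 :: 'k::field poly3 mat) = {0\<^sub>v 2}"
proof (intro equalityI subsetI)
  fix w :: "'k poly3 vec"
  assume "w \<in> mat_kernel E2"
  then have w: "w \<in> carrier_vec 2" "E2 *\<^sub>v w = 0\<^sub>v 5" by (auto simp: mat_kernel_def E2_def)
  have "w $ 0 = 0" "w $ 1 = 0"
    using arg_cong[OF w(2), of "\<lambda>t. t $ 0"] arg_cong[OF w(2), of "\<lambda>t. t $ 1"]
    unfolding E2_mult[OF w(1)] by (simp_all add: nth_Cons')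
  then show "w \<in> {0\<^sub>v 2}" using w(1) by (auto simp: less_2_cases' intro!: eq_vecI)
next
  fix w :: "'k poly3 vec"
  have "E2 *\<^sub>v 0\<^sub>v 2 = (0\<^sub>v 5 :: 'k poly3 vec)"
    unfolding E2_mult[OF zero_carrier_vec] by (intro eq_vecI) (auto simp: less_5_cases nth_Cons')
  moreover assume "w \<in> {0\<^sub>v 2}"
  ultimately show "w \<in> mat_kernel E2" by (simp add: mat_kernel_def) (simp add: E2_def)
qed

definition shifts :: "nat \<Rightarrow> int list"
  where "shifts i = (if i = 0 then [int (a + u), int (b + v), int (a + b), int c]
    else if i = 1 then [int (a + u + b), int (b + v + a), int (a + u + c), int (b + v + c), int (a + b + c)]
    else if i = 2 then [int (a + u + b + c), int (a + b + v + c)] else [])"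

definition differential :: "nat \<Rightarrow> 'k::field poly3 mat"
  where "differential i = (if i = 0 then E0 else if i = 1 then E1 else if i = 2 then E2
    else 0\<^sub>m (length (shifts (i - 1))) 0)"

lemma E_carrier [simp]: "E0 \<in> carrier_mat 1 4" "E1 \<in> carrier_mat 4 5" "E2 \<in> carrier_mat 5 2"
  by (simp_all add: E0_def E1_def E2_def)

lemma E_dim [simp]: "dim_row E0 = 1" "dim_col E0 = 4" "dim_row E1 = 4" "dim_col E1 = 5" "dim_row E2 = 5" "dim_col E2 = 2"
  by (simp_all add: E0_def E1_def E2_def)

lemma shifts_length [simp]: "length (shifts 0) = 4" "length (shifts 1) = 5" "length (shifts 2) = 2"
  by (simp_all add: shifts_def)

lemma hom_monomial: "homogeneous_of_degree (int a + int b) (X ^ a * Y ^ b)"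
  by (intro homogeneous_of_degree_mult homogeneous_of_degree_var_power)

lemma hom_power: "n = int m \<Longrightarrow> homogeneous_of_degree n (var i ^ m :: 'k::comm_ring_1 poly3)"
  by simp

lemma graded_E0: "graded_map (shifts 0) [0] (E0 :: 'k::field poly3 mat)"
  unfolding graded_map_def
proof (intro conjI allI impI)
  fix r j assume "r < length [0 :: int]" "j < length (shifts 0)"
  then have "r = 0" "j < 4" by (simp_all add: shifts_def)
  then show "homogeneous_of_degree (shifts 0 ! j - [0] ! r) (E0 $$ (r, j) :: 'k poly3)"
    unfolding less_4_cases by (auto simp: shifts_def E0_def nth_Cons' hom_monomial intro!: hom_power)
qed (simp flip: One_nat_def)

lemma graded_E1: "graded_map (shifts 1) (shifts 0) (E1 :: 'k::field poly3 mat)"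
  unfolding graded_map_def
proof (intro conjI allI impI)
  fix r j assume "r < length (shifts 0)" "j < length (shifts 1)"
  then have "r < 4" "j < 5" by (simp_all add: shifts_def)
  then show "homogeneous_of_degree (shifts 1 ! j - shifts 0 ! r) (E1 $$ (r, j) :: 'k poly3)"
    unfolding less_4_cases less_5_cases
    by (elim disjE; simp add: shifts_def E1_def nth_Cons' hom_monomial hom_power)
qed simp

lemma graded_E2: "graded_map (shifts 2) (shifts 1) (E2 :: 'k::field poly3 mat)"
  unfolding graded_map_def
proof (intro conjI allI impI)
  fix r j assume "r < length (shifts 1)" "j < length (shifts 2)"
  then have "r < 5" "j < 2" by (simp_all add: shifts_def)
  then show "homogeneous_of_degree (shifts 2 ! j - shifts 1 ! r) (E2 $$ (r, j) :: 'k poly3)"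
    unfolding less_2_cases' less_5_cases
    by (elim disjE; simp add: shifts_def E2_def nth_Cons' hom_power)
qed simp

lemma const_term_var_power: "0 < n \<Longrightarrow> Poly_Mapping.lookup (var i ^ n :: 'k::field poly3) 0 = 0"
  by (rule homogeneous_const_term_0[OF homogeneous_of_degree_var_power]) simp

lemma minimal_E1: "r < 4 \<Longrightarrow> j < 5 \<Longrightarrow> Poly_Mapping.lookup (E1 $$ (r, j) :: 'k::field poly3) 0 = 0"
  unfolding less_4_cases less_5_cases using pos
  by (elim disjE; simp add: E1_def nth_Cons' const_term_mult const_term_var_power)

lemma minimal_E2: "r < 5 \<Longrightarrow> j < 2 \<Longrightarrow> Poly_Mapping.lookup (E2 $$ (r, j) :: 'k::field poly3) 0 = 0"
  unfolding less_2_cases' less_5_cases using pos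
  by (elim disjE; simp add: E2_def nth_Cons' const_term_var_power)

lemma image_E0:
  "(\<lambda>w. w $ 0) ` mat_image E0 = (ideal_gen {X ^ (a + u), Y ^ (b + v), Z ^ c, X ^ a * Y ^ b} :: 'k::field poly3 set)"
    (is "?I = ideal_gen ?G")
proof
  interpret R: Modules.module "(*) :: 'k poly3 \<Rightarrow> 'k poly3 \<Rightarrow> 'k poly3" by (rule module_self)
  \<comment> \<open>Over the ring itself this rule is associativity, oriented against \<open>ac_simps\<close>.\<close>
  note R.scale_scale [simp del]
  show "?I \<subseteq> ideal_gen ?G"
  proof
    fix g assume "g \<in> ?I"
    then obtain w where w: "w \<in> carrier_vec 4" "g = (E0 *\<^sub>v w) $ 0"
      unfolding mat_image_def E_dim by blast
    have g: "g = w $ 0 * X ^ (a + u) + w $ 1 * Y ^ (b + v) + w $ 2 * (X ^ a * Y ^ b) + w $ 3 * Z ^ c"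
      unfolding w(2) E0_mult[OF w(1)] by (simp add: mult.commute)
    have h: "h * m \<in> R.span ?G" if "m \<in> ?G" for h m
      by (rule R.span_scale[OF R.span_base[OF that]])
    show "g \<in> ideal_gen ?G"
      unfolding ideal_gen_def g by (intro R.span_add h) simp_all
  qed
  show "ideal_gen ?G \<subseteq> ?I"
    unfolding ideal_gen_def
  proof (rule R.span_minimal)
    interpret S: short_resolution "shifts 0" "shifts 1" "shifts 2" E0 E1 "E2 :: 'k poly3 mat"
      by (intro short_resolution.intro graded_E0 graded_E1 graded_E2 exact_E0 exact_E1) (simp only: shifts_length inj_E2)
    show "R.subspace ?I"
      using S.is_ideal_ideal unfolding is_ideal_def S.ideal_def .
    have mem: "(E0 *\<^sub>v w) $ 0 \<in> ?I" if "w \<in> carrier_vec 4" for w :: "'k poly3 vec"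
    proof (rule imageI)
      show "E0 *\<^sub>v w \<in> mat_image E0" unfolding mat_image_def E_dim using that by blast
    qed
    have e: "(E0 *\<^sub>v unit_vec 4 0) $ 0 = X ^ (a + u)" "(E0 *\<^sub>v unit_vec 4 1) $ 0 = Y ^ (b + v)"
      "(E0 *\<^sub>v unit_vec 4 2) $ 0 = X ^ a * Y ^ b" "(E0 *\<^sub>v unit_vec 4 3) $ 0 = (Z ^ c :: 'k poly3)"
      unfolding E0_mult[OF unit_vec_carrier] by simp_all
    show "?G \<subseteq> ?I"
      using mem[of "unit_vec 4 0"] mem[of "unit_vec 4 1"] mem[of "unit_vec 4 2"] mem[of "unit_vec 4 3"]
      unfolding e by simp
  qed
qed

theorem minimal_resolution:
  "minimal_graded_free_resolution shifts differential
    (ideal_gen {X ^ (a + u), Y ^ (b + v), Z ^ c, X ^ a * Y ^ b} :: 'k::field poly3 set)"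
  unfolding minimal_graded_free_resolution_def
proof (intro conjI allI impI)
  let ?D = "differential :: nat \<Rightarrow> 'k poly3 mat"
  have D: "?D 0 = E0" "?D 1 = E1" "?D 2 = E2" by (simp_all add: differential_def)
  have high: "shifts i = []" "?D i = 0\<^sub>m (length (shifts (i - 1))) 0" if "3 \<le> i" for i
    using that by (simp_all add: shifts_def differential_def)
  have target: "target_shifts shifts 0 = [0]" "target_shifts shifts 1 = shifts 0" "target_shifts shifts 2 = shifts 1"
    by (simp_all add: target_shifts_def One_nat_def numeral_2_eq_2)
  have trivial: "mat_image (0\<^sub>m n 0 :: 'k poly3 mat) = {0\<^sub>v n}" "mat_kernel (0\<^sub>m n 0 :: 'k poly3 mat) = {0\<^sub>v 0}" for n
  proof -
    have e: "0\<^sub>m n 0 *\<^sub>v w = 0\<^sub>v n" if "w \<in> carrier_vec 0" for w :: "'k poly3 vec"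
      using that by (intro eq_vecI) (auto simp: scalar_prod_def)
    then show "mat_image (0\<^sub>m n 0 :: 'k poly3 mat) = {0\<^sub>v n}"
      using e[of "0\<^sub>v 0"] by (auto simp: mat_image_def intro!: exI[of _ "0\<^sub>v 0"])
    show "mat_kernel (0\<^sub>m n 0 :: 'k poly3 mat) = {0\<^sub>v 0}"
      using e[of "0\<^sub>v 0"] by (auto simp: mat_kernel_def intro!: eq_vecI)
  qed
  show "graded_map (shifts i) (target_shifts shifts i) (?D i)" for i
  proof -
    consider "i = 0" | "i = 1" | "i = 2" | "3 \<le> i" by linarith
    then show ?thesis
    proof cases
      case 4
      then have "target_shifts shifts i = shifts (i - 1)" by (simp add: target_shifts_def split: nat.split)
      then show ?thesis using high[OF 4] by (simp add: graded_map_def)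
    qed (simp_all add: D target graded_E0 graded_E1 graded_E2)
  qed
  show "(\<lambda>w. w $ 0) ` mat_image (?D 0) = ideal_gen {X ^ (a + u), Y ^ (b + v), Z ^ c, X ^ a * Y ^ b}"
    by (simp add: D image_E0)
  show "mat_kernel (?D i) = mat_image (?D (Suc i))" for i
  proof -
    consider "i = 0" | "i = 1" | "i = 2" | "3 \<le> i" by linarith
    then show ?thesis
    proof cases
      case 1
      then show ?thesis using D exact_E0 by (simp flip: One_nat_def)
    next
      case 2
      then show ?thesis using D exact_E1 by (simp add: Suc_1)
    next
      case 3
      then show ?thesis using D inj_E2 high(2)[of 3] trivial(1)[of 2] by simp
    next
      case 4
      then show ?thesis using high[of i] high[of "Suc i"] by (simp add: trivial)
    qed
  qed
  show "Poly_Mapping.lookup (?D (Suc i) $$ (r, j)) 0 = 0"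
    if "r < dim_row (?D (Suc i))" "j < dim_col (?D (Suc i))" for i r j
  proof -
    consider "Suc i = 1" | "Suc i = 2" | "3 \<le> Suc i" by linarith
    then show ?thesis
    proof cases
      case 1
      then show ?thesis using that minimal_E1 unfolding 1 D by simp
    next
      case 2
      then show ?thesis using that minimal_E2 unfolding 2 D by simp
    next
      case 3
      then show ?thesis using that high(2)[of "Suc i"] by simp
    qed
  qed
qed

end

section \<open>Betti numbers of almost complete intersections of type two\<close>

theorem corollary4p13:
  fixes I :: "'k::field poly3 set"
    and F :: "nat \<Rightarrow> int list" and D :: "nat \<Rightarrow> 'k poly3 mat"
    and d d1 d2 d3 dst s1 s2 :: nat
  assumes "infinite (UNIV :: 'k set)"
    and "almost_complete_intersection3 I"
    and "cm_type I = 2"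
    and "minimal_graded_free_resolution F D I"
    and "mset (F 0) = image_mset int {#d1, d2, d3, dst#}"
    and "mset (F 1) = image_mset int {#s1, s2, d1 + dst, d2 + dst, d3 + dst#}"
    and "mset (F 2) = {#int d - int s1, int d - int s2#}"
    and "\<forall>i\<ge>3. F i = []"
    and "d = d1 + d2 + d3 + dst"
    and "d1 \<le> d2" and "d2 \<le> d3" and "s1 \<le> s2"
  shows "d3 \<le> s2 \<and> d2 \<le> s1 \<and>
    (\<forall>i j. graded_betti I i j =
       graded_betti (ideal_gen {X ^ d2, Y ^ d3, Z ^ dst, X ^ (s2 - d3) * Y ^ (s1 - d2)} :: 'k poly3 set) i j)"
proof -
  note R = assms(4)
  note r = resolution_maps[OF R]
  have F: "F i = []" if "3 \<le> i" for i using assms(8) that by blast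
  interpret S: short_resolution "F 0" "F 1" "F 2" "D 0" "D 1" "D 2"
    by (rule short_resolution_of_minimal[OF R F]) simp
  have ideal: "S.ideal = I" unfolding S.ideal_def by (rule r(7))
  have "artinian_quotient S.ideal"
    using assms(2) unfolding ideal almost_complete_intersection3_def by blast
  then obtain N where N: "\<And>i. var i ^ N \<in> S.ideal" using S.artinian_var_powers by blast
  interpret M: minimal_finite_length_resolution "F 0" "F 1" "F 2" "D 0" "D 1" "D 2" N
  proof
    show "Poly_Mapping.lookup (D 1 $$ (r, j)) 0 = 0" if "r < length (F 0)" "j < length (F 1)" for r j
      using r(6)[of r 0 j] that by (simp add: One_nat_def)
    show "Poly_Mapping.lookup (D 2 $$ (r, j)) 0 = 0" if "r < length (F 1)" "j < length (F 2)" for r j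
      using r(6)[of r 1 j] that by (simp add: Suc_1)
    show "var i ^ N \<in> S.ideal" for i by (rule N)
  qed
  have bounds: "0 < dst" "s1 + s2 = d1 + d2 + d3" "d3 < s2" "d2 < s1"
    using M.type_two_shift_bounds[OF assms(5,6,7,9-12)] by auto
  define a u b v where "a = s2 - d3" and "u = d2 - a" and "b = s1 - d2" and "v = d3 - b"
  have eqs: "a + u = d2" "b + v = d3" "a + b = d1" "s1 = a + u + b" "s2 = b + v + a" "0 < a" "0 < u" "0 < b" "0 < v"
    unfolding a_def u_def b_def v_def using bounds assms(10-12) by simp_all
  interpret J: monomial_ideal a u b v dst
    by unfold_locales (use eqs bounds in simp_all)
  have J: "minimal_graded_free_resolution J.shifts J.differential
     (ideal_gen {X ^ d2, Y ^ d3, Z ^ dst, X ^ (s2 - d3) * Y ^ (s1 - d2)} :: 'k poly3 set)"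
    using J.minimal_resolution[where 'k = 'k] eqs(1,2) unfolding a_def b_def by simp
  have "mset (F i) = mset (J.shifts i)" for i
  proof -
    consider "i = 0" | "i = 1" | "i = 2" | "3 \<le> i" by linarith
    then show ?thesis
    proof cases
      case 1
      then show ?thesis unfolding 1 assms(5) J.shifts_def eqs(1-3) by (simp add: add_mset_commute)
    next
      case 2
      have "int s1 = int d2 + int b" "int s2 = int d3 + int a" using eqs(1,2,4,5) by simp_all
      then show ?thesis unfolding 2 assms(6) J.shifts_def eqs(1-3) by (simp add: add_mset_commute)
    next
      case 3
      have "int d - int s1 = int (a + b + v + dst)" "int d - int s2 = int (a + u + b + dst)"
        unfolding assms(9) eqs(4,5) eqs(1)[symmetric] eqs(2)[symmetric] eqs(3)[symmetric] by simp_all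
      then show ?thesis unfolding 3 assms(7) J.shifts_def by (simp add: add_mset_commute)
    next
      case 4
      then show ?thesis using F[OF 4] by (simp add: J.shifts_def)
    qed
  qed
  then show ?thesis
    using bounds by (simp add: graded_betti_eq[OF R] graded_betti_eq[OF J])
qed

end
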